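(* Let $(M,\|\cdot\|)$ be a Finsler manifold. If for some $k\in\mathbb N$ there exists a path isometry $$f:(M,\|\cdot\|)\to\mathbb E^k,$$ then the manifold is in fact Riemannian, i.e. for every $p\in M$ the norm $\|\cdot\|$ on $T_pM$ is induced by a scalar product on $T_pM$.
   Context: A Finsler manifold $(M,\|\cdot\|)$ is a (connected) smooth manifold $M$ with a continuous function $\|\cdot\|:TM\to[0,\infty)$ whose restriction to each tangent space $T_pM$ is a norm; $M$ is regarded as a metric space with the distance given by the infimum of $\int\|\dot\gamma\|\,dt$ over (piecewise smooth) curves $\gamma$ joining two points. $\mathbb E^k$ denotes $\mathbb R^k$ with the Euclidean distance. For a metric space $X$, $L_X(\gamma)\in[0,\infty]$ denotes the length of a (continuous, parametrized) curve with respect to the distance of $X$. A map $f:X\to Y$ between metric spaces is a path isometry if $L_Y(f\circ\gamma)=L_X(\gamma)$ for all curves $\gamma$ in $X$; it need not be injective. *)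

theory Defs
  imports "HOL-Analysis.Analysis"
begin

section \<open>Curves and path isometries in metric spaces\<close>

text \<open>
  A metric space is given by a carrier set and a distance function, since the Finsler distance
  below is not the distance of a type class instance. Curves are parametrized by an arbitrary
  compact interval.
\<close>

definition curve_in :: "'a set \<Rightarrow> ('a \<Rightarrow> 'a \<Rightarrow> real) \<Rightarrow> real \<Rightarrow> real \<Rightarrow> (real \<Rightarrow> 'a) \<Rightarrow> bool" where
  "curve_in X d a b \<gamma> \<longleftrightarrow> a \<le> b \<and> \<gamma> \<in> {a..b} \<rightarrow> X \<and>
     (\<forall>t\<in>{a..b}. \<forall>\<epsilon>>0. \<exists>\<delta>>0. \<forall>s\<in>{a..b}. \<bar>s - t\<bar> < \<delta> \<longrightarrow> d (\<gamma> t) (\<gamma> s) < \<epsilon>)"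

definition subdivision :: "real \<Rightarrow> real \<Rightarrow> nat \<Rightarrow> (nat \<Rightarrow> real) \<Rightarrow> bool" where
  "subdivision a b n \<tau> \<longleftrightarrow> \<tau> 0 = a \<and> \<tau> n = b \<and> mono_on {..n} \<tau>"

definition curve_length :: "('a \<Rightarrow> 'a \<Rightarrow> real) \<Rightarrow> real \<Rightarrow> real \<Rightarrow> (real \<Rightarrow> 'a) \<Rightarrow> ennreal" where
  "curve_length d a b \<gamma> =
     (SUP (n, \<tau>) \<in> {(n, \<tau>). subdivision a b n \<tau>}. \<Sum>i<n. ennreal (d (\<gamma> (\<tau> i)) (\<gamma> (\<tau> (Suc i)))))"

definition path_isometry ::
  "'a set \<Rightarrow> ('a \<Rightarrow> 'a \<Rightarrow> real) \<Rightarrow> 'b set \<Rightarrow> ('b \<Rightarrow> 'b \<Rightarrow> real) \<Rightarrow> ('a \<Rightarrow> 'b) \<Rightarrow> bool" where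
  "path_isometry X d Y d' f \<longleftrightarrow> f \<in> X \<rightarrow> Y \<and>
     (\<forall>a b \<gamma>. curve_in X d a b \<gamma> \<longrightarrow> curve_length d' a b (f \<circ> \<gamma>) = curve_length d a b \<gamma>)"

text \<open>
  Euclidean distance on the carrier of \<^const>\<open>Euclidean_space\<close> \<open>k\<close>, that is, on the sequences
  vanishing from index \<open>k\<close> on; \<open>k = 0\<close> is allowed.
\<close>

definition euclid_dist :: "nat \<Rightarrow> (nat \<Rightarrow> real) \<Rightarrow> (nat \<Rightarrow> real) \<Rightarrow> real" where
  "euclid_dist k x y = L2_set (\<lambda>i. x i - y i) {..<k}"

section \<open>Smooth maps and smooth manifolds\<close>

text \<open>
  \<open>C\<^sup>n\<close> maps, by iterated directional derivatives. The set \<open>S\<close> is an open subset of a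
  finite-dimensional space, or a relatively open subset of a compact interval, where derivatives
  at the endpoints of the interval are one-sided.
\<close>

primrec times_cont_diff_on ::
  "nat \<Rightarrow> 'e::real_normed_vector set \<Rightarrow> ('e \<Rightarrow> 'f::real_normed_vector) \<Rightarrow> bool" where
  "times_cont_diff_on 0 S f \<longleftrightarrow> continuous_on S f"
| "times_cont_diff_on (Suc n) S f \<longleftrightarrow>
     (\<exists>f'. (\<forall>x\<in>S. (f has_derivative f' x) (at x within S)) \<and>
           (\<forall>v. times_cont_diff_on n S (\<lambda>x. f' x v)))"

definition smooth_on ::
  "'e::real_normed_vector set \<Rightarrow> ('e \<Rightarrow> 'f::real_normed_vector) \<Rightarrow> bool" where
  "smooth_on S f \<longleftrightarrow> (\<forall>n. times_cont_diff_on n S f)"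

text \<open>
  A chart is its domain together with its coordinate map, whose values outside the domain are
  irrelevant. The model space \<open>'e\<close> is a real normed space that is finite-dimensional, because
  it satisfies the Heine--Borel property (Riesz); in contrast to the class of Euclidean spaces,
  this includes dimension \<open>0\<close>. The manifold is the whole type \<open>'a\<close> with its topology.
\<close>

type_synonym ('a, 'e) chart = "'a set \<times> ('a \<Rightarrow> 'e)"

definition transition :: "('a, 'e) chart \<Rightarrow> ('a, 'e) chart \<Rightarrow> 'e \<Rightarrow> 'e" where
  "transition c c' = snd c' \<circ> inv_into (fst c) (snd c)"

locale smooth_manifold =
  fixes A :: "('a::{t2_space,second_countable_topology},
               'e::{real_normed_vector,heine_borel}) chart set"
  assumes connected: "connected (UNIV :: 'a set)"
    and cover: "(\<Union>c\<in>A. fst c) = UNIV"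
    and chart: "\<And>U \<phi>. (U, \<phi>) \<in> A \<Longrightarrow>
          open U \<and> open (\<phi> ` U) \<and> homeomorphism U (\<phi> ` U) \<phi> (inv_into U \<phi>)"
    and compatible: "\<And>c c'. c \<in> A \<Longrightarrow> c' \<in> A \<Longrightarrow>
          smooth_on (snd c ` (fst c \<inter> fst c')) (transition c c')"

section \<open>Tangent vectors\<close>

text \<open>
  A tangent vector at \<open>p\<close> assigns to every chart around \<open>p\<close> its coordinates in that chart,
  and these transform by the derivatives of the transition maps. (The value at all other charts is
  fixed to be \<open>0\<close>.) The vector space operations on a tangent space are the pointwise ones.
\<close>

type_synonym ('a, 'e) tangent = "('a, 'e) chart \<Rightarrow> 'e"

definition charts_at :: "('a, 'e) chart set \<Rightarrow> 'a \<Rightarrow> ('a, 'e) chart set" where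
  "charts_at A p = {c \<in> A. p \<in> fst c}"

definition transition_deriv ::
  "('a, 'e::real_normed_vector) chart \<Rightarrow> ('a, 'e) chart \<Rightarrow> 'a \<Rightarrow> 'e \<Rightarrow> 'e" where
  "transition_deriv c c' p = frechet_derivative (transition c c') (at (snd c p))"

definition tangent_space ::
  "('a, 'e::real_normed_vector) chart set \<Rightarrow> 'a \<Rightarrow> ('a, 'e) tangent set" where
  "tangent_space A p =
     {v. (\<forall>c\<in>charts_at A p. \<forall>c'\<in>charts_at A p. v c' = transition_deriv c c' p (v c)) \<and>
         (\<forall>c. c \<notin> charts_at A p \<longrightarrow> v c = 0)}"

text \<open>The tangent vector at \<open>p\<close> whose coordinates in the chart \<open>c\<close> are \<open>\<xi>\<close>:\<close>

definition tangent_vector ::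
  "('a, 'e::real_normed_vector) chart set \<Rightarrow> ('a, 'e) chart \<Rightarrow> 'a \<Rightarrow> 'e \<Rightarrow> ('a, 'e) tangent" where
  "tangent_vector A c p \<xi> = (\<lambda>c'. if c' \<in> charts_at A p then transition_deriv c c' p \<xi> else 0)"

definition norm_on :: "('c \<Rightarrow> 'e::real_vector) set \<Rightarrow> (('c \<Rightarrow> 'e) \<Rightarrow> real) \<Rightarrow> bool" where
  "norm_on V N \<longleftrightarrow>
     (\<forall>v\<in>V. N v \<ge> 0 \<and> (N v = 0 \<longleftrightarrow> v = (\<lambda>c. 0))) \<and>
     (\<forall>v\<in>V. \<forall>r. N (\<lambda>c. r *\<^sub>R v c) = \<bar>r\<bar> * N v) \<and>
     (\<forall>v\<in>V. \<forall>w\<in>V. N (\<lambda>c. v c + w c) \<le> N v + N w)"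

definition scalar_product_on ::
  "('c \<Rightarrow> 'e::real_vector) set \<Rightarrow> (('c \<Rightarrow> 'e) \<Rightarrow> ('c \<Rightarrow> 'e) \<Rightarrow> real) \<Rightarrow> bool" where
  "scalar_product_on V g \<longleftrightarrow>
     (\<forall>v\<in>V. \<forall>w\<in>V. g v w = g w v) \<and>
     (\<forall>u\<in>V. \<forall>v\<in>V. \<forall>w\<in>V. g (\<lambda>c. u c + v c) w = g u w + g v w) \<and>
     (\<forall>v\<in>V. \<forall>w\<in>V. \<forall>r. g (\<lambda>c. r *\<^sub>R v c) w = r * g v w) \<and>
     (\<forall>v\<in>V. v \<noteq> (\<lambda>c. 0) \<longrightarrow> g v v > 0)"

section \<open>Finsler manifolds\<close>

text \<open>
  Continuity on the tangent bundle is continuity in the local trivializations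
  \<open>(p, \<xi>) \<mapsto> tangent_vector A c p \<xi>\<close>, which define the topology of the bundle.
\<close>

locale finsler_manifold = smooth_manifold A
  for A :: "('a::{t2_space,second_countable_topology},
             'e::{real_normed_vector,heine_borel}) chart set" +
  fixes N :: "'a \<Rightarrow> ('a, 'e) tangent \<Rightarrow> real"
  assumes norm: "\<And>p. norm_on (tangent_space A p) (N p)"
    and continuous: "\<And>c. c \<in> A \<Longrightarrow>
          continuous_on (fst c \<times> UNIV) (\<lambda>(p, \<xi>). N p (tangent_vector A c p \<xi>))"

definition smooth_curve_on ::
  "('a, 'e::real_normed_vector) chart set \<Rightarrow> real set \<Rightarrow> (real \<Rightarrow> 'a) \<Rightarrow> bool" where
  "smooth_curve_on A J \<gamma> \<longleftrightarrow> (\<forall>c\<in>A. smooth_on {t \<in> J. \<gamma> t \<in> fst c} (snd c \<circ> \<gamma>))"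

definition piecewise_smooth_curve ::
  "('a::topological_space, 'e::real_normed_vector) chart set \<Rightarrow> real \<Rightarrow> real \<Rightarrow> (real \<Rightarrow> 'a) \<Rightarrow> bool"
  where
  "piecewise_smooth_curve A a b \<gamma> \<longleftrightarrow> a \<le> b \<and> continuous_on {a..b} \<gamma> \<and>
     (\<exists>n \<tau>. subdivision a b n \<tau> \<and> (\<forall>i<n. smooth_curve_on A {\<tau> i..\<tau> (Suc i)} \<gamma>))"

text \<open>
  At the finitely many break points of a piecewise smooth curve the velocity may have no meaning;
  they do not contribute to the integral below.
\<close>

definition velocity ::
  "('a, 'e::real_normed_vector) chart set \<Rightarrow> real \<Rightarrow> real \<Rightarrow> (real \<Rightarrow> 'a) \<Rightarrow> real \<Rightarrow> ('a, 'e) tangent"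
  where
  "velocity A a b \<gamma> t =
     (\<lambda>c. if c \<in> charts_at A (\<gamma> t) then vector_derivative (snd c \<circ> \<gamma>) (at t within {a..b}) else 0)"

definition finsler_dist ::
  "('a::topological_space, 'e::real_normed_vector) chart set \<Rightarrow> ('a \<Rightarrow> ('a, 'e) tangent \<Rightarrow> real)
     \<Rightarrow> 'a \<Rightarrow> 'a \<Rightarrow> real" where
  "finsler_dist A N p q =
     Inf {integral {a..b} (\<lambda>t. N (\<gamma> t) (velocity A a b \<gamma> t)) | a b \<gamma>.
            piecewise_smooth_curve A a b \<gamma> \<and> \<gamma> a = p \<and> \<gamma> b = q}"

end

theory Submission
  imports Defs
begin

text \<open>
  Why a path isometry \<open>f\<close> into \<open>\<real>\<^sup>k\<close> forces the norms to be Euclidean. Fix a point \<open>p\<close>, a chart around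
  it and let \<open>n\<close> be the norm of \<open>T\<^sub>pM\<close> in the coordinates of this chart. At a small scale
  the metric looks like \<open>n\<close>: for points with coordinates \<open>x\<close> and \<open>y\<close> close to \<open>p\<close>, the Finsler
  distance lies between \<open>(1 - \<epsilon>) n (y - x)\<close> and \<open>(1 + \<epsilon>) n (y - x)\<close>
  (\<open>finsler_dist_infinitesimal\<close>). Since \<open>f\<close> preserves the length of coordinate segments, the
  function \<open>F\<close> that expresses \<open>f\<close> in coordinates satisfies \<open>\<bar>F y - F x\<bar> \<le> (1 + \<epsilon>) n (y - x)\<close>, while
  the image of the segment from \<open>x\<close> to \<open>y\<close> has length at least \<open>(1 - \<epsilon>) n (y - x)\<close>.

  The lower bound concerns lengths and not distances, because \<open>F\<close> may fold segments. Differentiating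
  \<open>F\<close> almost everywhere would turn it into a pointwise statement; the following averaging argument
  needs no derivative. In a Euclidean space the squares of the diagonals of any quadrilateral add up
  to at most the sum of the squares of its sides (\<open>euclid_dist_quadrilateral\<close>). Divide the
  parallelogram spanned by short vectors \<open>v\<close> and \<open>w\<close> into \<open>M\<^sup>2\<close> cells and apply this to the
  images of the quadrilateral in each cell whose vertices are the midpoints of the sides of the cell.
  Its diagonals are parallel to \<open>v\<close> and \<open>w\<close>, its sides are \<open>(\<plusminus>v \<plusminus> w) / 2M\<close>. Along a row of cells
  the diagonals parallel to \<open>v\<close> are consecutive, so for large \<open>M\<close> their images have total length
  close to the length of the image of the whole segment, uniformly in the row by a Dini argument. Summing
  over all cells with the Cauchy--Schwarz inequality gives, up to factors tending to \<open>1\<close>,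
  \<open>2 (n v)\<^sup>2 + 2 (n w)\<^sup>2 \<le> (n (v + w))\<^sup>2 + (n (v - w))\<^sup>2\<close>
  (\<open>parallelogram_estimate\<close>, \<open>coord_norm_parallelogram\<close>). This holds for all \<open>v\<close> and \<open>w\<close> by
  homogeneity, hence with equality, as one sees by inserting \<open>v + w\<close> and \<open>v - w\<close>. A norm
  satisfying the parallelogram law comes from a scalar product (\<open>jordan_von_neumann\<close>).
\<close>

section \<open>Norms on a vector space\<close>

text \<open>
  Several norms on the same vector space have to be compared, so they are functions and not the
  norm of the type class.
\<close>

definition norm_function :: "('e::real_vector \<Rightarrow> real) \<Rightarrow> bool" where
  "norm_function n \<longleftrightarrow> (\<forall>v. n v = 0 \<longleftrightarrow> v = 0) \<and> (\<forall>r v. n (r *\<^sub>R v) = \<bar>r\<bar> * n v) \<and>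
     (\<forall>v w. n (v + w) \<le> n v + n w)"

lemma norm_function_eq_0: "norm_function n \<Longrightarrow> n v = 0 \<longleftrightarrow> v = 0"
  and norm_function_scale: "norm_function n \<Longrightarrow> n (r *\<^sub>R v) = \<bar>r\<bar> * n v"
  and norm_function_triangle: "norm_function n \<Longrightarrow> n (v + w) \<le> n v + n w"
  by (auto simp: norm_function_def)

lemma norm_function_minus: "norm_function n \<Longrightarrow> n (- v) = n v"
  using norm_function_scale[of n "-1" v] by simp

lemma norm_function_minus_commute: "norm_function n \<Longrightarrow> n (v - w) = n (w - v)"
  using norm_function_minus[of n "v - w"] by simp

lemma norm_function_nonneg: 
  assumes "norm_function n" shows "n v \<ge> 0"
  using norm_function_triangle[OF assms, of v "- v"] norm_function_minus[OF assms, of v]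
    norm_function_eq_0[OF assms, of 0] by simp

lemma norm_function_sum_le:
  assumes "norm_function n"
  shows "n (\<Sum>i\<in>I. v i) \<le> (\<Sum>i\<in>I. n (v i))"
proof (induction I rule: infinite_finite_induct)
  case (insert x F)
  then show ?case using norm_function_triangle[OF assms, of "v x" "sum v F"] by simp
qed (use norm_function_eq_0[OF assms, of 0] in auto)

text \<open>
  The minimum of \<open>n\<close> on the unit sphere, which is compact by the Heine--Borel property, serves as the
  constant. The sphere is empty in dimension \<open>0\<close>.
\<close>

lemma norm_function_ge_norm:
  fixes n :: "'e::{real_normed_vector,heine_borel} \<Rightarrow> real"
  assumes n: "norm_function n" and cont: "continuous_on UNIV n"
  obtains \<kappa> where "\<kappa> > 0" "\<And>v. \<kappa> * norm v \<le> n v"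
proof (cases "sphere (0::'e) 1 = {}")
  case True
  have "v = 0" for v :: 'e
  proof (rule ccontr)
    assume "v \<noteq> 0"
    then have "v /\<^sub>R norm v \<in> sphere 0 1" by simp
    with True show False by blast
  qed
  then have "1 * norm v \<le> n v" for v
    using norm_function_nonneg[OF n, of v] by (metis mult_1 norm_zero)
  then show thesis using that[of 1] by simp
next
  case False
  have "sphere (0::'e) 1 = cball 0 1 - ball 0 1" by auto
  then have "closed (sphere (0::'e) 1)" using closed_Diff by (metis closed_cball open_ball)
  then have "compact (sphere (0::'e) 1)"
    by (auto simp: compact_eq_bounded_closed bounded_iff)
  then obtain u where u: "u \<in> sphere 0 1" "\<And>v. v \<in> sphere 0 1 \<Longrightarrow> n u \<le> n v"
    using continuous_attains_inf[OF _ False continuous_on_subset[OF cont subset_UNIV]] by blast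
  have "u \<noteq> 0" using u(1) by auto
  show thesis
  proof (rule that)
    show "n u > 0"
      using norm_function_nonneg[OF n, of u] norm_function_eq_0[OF n, of u] \<open>u \<noteq> 0\<close> by linarith
    show "n u * norm v \<le> n v" for v
    proof (cases "v = 0")
      case True
      then show ?thesis using norm_function_nonneg[OF n, of v] by simp
    next
      case False
      then have "n u \<le> n (v /\<^sub>R norm v)" by (intro u(2)) simp
      also have "\<dots> = n v / norm v" 
        by (simp add: norm_function_scale[OF n] divide_inverse mult.commute)
      finally show ?thesis using False by (simp add: field_simps)
    qed
  qed
qed

lemma norm_function_le_norm:
  fixes n :: "'e::real_normed_vector \<Rightarrow> real"
  assumes n: "norm_function n" and cont: "continuous_on UNIV n"
  obtains K where "K > 0" "\<And>v. n v \<le> K * norm v"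
proof -
  have "isCont n 0" using cont by (simp add: continuous_on_eq_continuous_at)
  then obtain d where d: "d > 0" "\<And>v. norm v < d \<Longrightarrow> \<bar>n v\<bar> < 1"
    using norm_function_eq_0[OF n, of 0] unfolding continuous_at_eps_delta
    by (metis dist_norm diff_zero real_norm_def zero_less_one)
  show thesis
  proof (rule that)
    show "2 / d > 0" using d by simp
    show "n v \<le> 2 / d * norm v" for v
    proof (cases "v = 0")
      case True
      then show ?thesis using norm_function_eq_0[OF n, of 0] by simp
    next
      case False
      let ?r = "d / (2 * norm v)"
      have "n (?r *\<^sub>R v) < 1" using d(2)[of "?r *\<^sub>R v"] d(1) False by simp
      then have "?r * n v < 1" using d(1) by (simp add: norm_function_scale[OF n])
      then show ?thesis using d(1) False by (simp add: field_simps)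
    qed
  qed
qed

text \<open>
  The mean value inequality for an arbitrary continuous norm and a merely integrable bound on the
  speed. On a sufficiently fine tagged division each increment of \<open>u\<close> is close to the derivative at
  the tag times the length of the interval, so the sum of the norms of the increments is at most a
  Riemann sum of \<open>g\<close> plus a small error. Arguing with Riemann sums of the real function \<open>g\<close> avoids
  vector-valued integrals, and with them completeness of the vector space.
\<close>

lemma norm_function_increment_le_integral_closed:
  fixes u :: "real \<Rightarrow> 'e::real_normed_vector"
  assumes n: "norm_function n" "continuous_on UNIV n" and ab: "a \<le> b"
    and u: "\<And>t. t \<in> {a..b} \<Longrightarrow> (u has_vector_derivative u' t) (at t within {a..b})"
    and g: "g integrable_on {a..b}" and le: "\<And>t. t \<in> {a..b} \<Longrightarrow> n (u' t) \<le> g t"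
  shows "n (u b - u a) \<le> integral {a..b} g"
proof (rule field_le_epsilon)
  fix e :: real assume "e > 0"
  obtain K where K: "K > 0" "\<And>v. n v \<le> K * norm v" using norm_function_le_norm[OF n] by blast
  define L where "L = b - a + 1"
  have L: "L > 0" "b - a \<le> L" using ab by (simp_all add: L_def)
  define \<eta> where "\<eta> = e / (2 * K * L)"
  have \<eta>: "\<eta> > 0" using \<open>e > 0\<close> K(1) L by (simp add: \<eta>_def)
  have "K * \<eta> * (b - a) \<le> K * \<eta> * L" using K(1) \<eta> L by simp
  also have "\<dots> = e / 2" using K(1) L by (simp add: \<eta>_def)
  finally have small: "K * \<eta> * (b - a) \<le> e / 2" .
  have "\<forall>x. \<exists>d>0. x \<in> {a..b} \<longrightarrow>
      (\<forall>y\<in>{a..b}. norm (y - x) < d \<longrightarrow> norm (u y - u x - (y - x) *\<^sub>R u' x) \<le> \<eta> * norm (y - x))"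
    using u[unfolded has_vector_derivative_def has_derivative_within_alt] \<eta>
    by (metis zero_less_one)
  then obtain d where d: "\<And>x. 0 < d x"
    "\<And>x y. x \<in> {a..b} \<Longrightarrow> y \<in> {a..b} \<Longrightarrow> \<bar>y - x\<bar> < d x \<Longrightarrow>
      norm (u y - u x - (y - x) *\<^sub>R u' x) \<le> \<eta> * \<bar>y - x\<bar>"
    by (metis real_norm_def)
  obtain \<gamma> where \<gamma>: "gauge \<gamma>"
    "\<And>\<D>. \<D> tagged_division_of {a..b} \<Longrightarrow> \<gamma> fine \<D> \<Longrightarrow>
      norm ((\<Sum>(x,k)\<in>\<D>. measure lborel k *\<^sub>R g x) - integral {a..b} g) < e / 2"
    using integrable_integral[OF g] \<open>e > 0\<close> unfolding has_integral_real by (metis half_gt_zero)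
  obtain \<D> where D: "\<D> tagged_division_of {a..b}" "\<gamma> fine \<D>" "(\<lambda>x. ball x (d x)) fine \<D>"
    using fine_division_exists_real[OF gauge_Int[OF \<gamma>(1) gauge_ball_dependent], of d a b] d(1) fine_Int
    by metis
  let ?G = "\<Sum>(x,k)\<in>\<D>. measure lborel k *\<^sub>R g x"
  have piece: "n (u (Sup k) - u (Inf k)) \<le> measure lborel k * g x + K * \<eta> * (Sup k - Inf k)"
    if xk: "(x, k) \<in> \<D>" for x k
  proof -
    obtain l r where k: "k = {l..r}" using tagged_division_ofD(4)[OF D(1) xk] by auto
    have x: "x \<in> {l..r}" "{l..r} \<subseteq> {a..b}"
      using tagged_division_ofD(2,3)[OF D(1) xk] k by auto
    have lr: "l \<in> {a..b}" "r \<in> {a..b}" "x \<in> {a..b}" "l \<le> r" using x by auto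
    have "k \<subseteq> ball x (d x)" using D(3) xk unfolding fine_def by blast
    then have "\<bar>l - x\<bar> < d x" "\<bar>r - x\<bar> < d x" using k lr(4) by (auto simp: subset_iff dist_real_def)
    then have "norm (u l - u x - (l - x) *\<^sub>R u' x) \<le> \<eta> * (x - l)"
      "norm (u r - u x - (r - x) *\<^sub>R u' x) \<le> \<eta> * (r - x)"
      using d(2)[of x l] d(2)[of x r] lr x by auto
    then have "norm ((u r - u x - (r - x) *\<^sub>R u' x) - (u l - u x - (l - x) *\<^sub>R u' x)) \<le> \<eta> * (r - l)"
      using norm_triangle_ineq4[of "u r - u x - (r - x) *\<^sub>R u' x" "u l - u x - (l - x) *\<^sub>R u' x"]
      by (simp add: algebra_simps)
    moreover have "(u r - u x - (r - x) *\<^sub>R u' x) - (u l - u x - (l - x) *\<^sub>R u' x) = (u r - u l) - (r - l) *\<^sub>R u' x"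
      by (simp add: algebra_simps)
    ultimately have err: "norm ((u r - u l) - (r - l) *\<^sub>R u' x) \<le> \<eta> * (r - l)" by simp
    have "n (u r - u l) \<le> n ((r - l) *\<^sub>R u' x) + n ((u r - u l) - (r - l) *\<^sub>R u' x)"
      using norm_function_triangle[OF n(1), of "(r - l) *\<^sub>R u' x" "(u r - u l) - (r - l) *\<^sub>R u' x"] by simp
    also have "\<dots> \<le> (r - l) * g x + K * (\<eta> * (r - l))"
    proof (rule add_mono)
      show "n ((r - l) *\<^sub>R u' x) \<le> (r - l) * g x"
        using le[of x] lr by (simp add: norm_function_scale[OF n(1)] mult_left_mono)
      show "n ((u r - u l) - (r - l) *\<^sub>R u' x) \<le> K * (\<eta> * (r - l))"
        using K(2)[of "(u r - u l) - (r - l) *\<^sub>R u' x"] mult_left_mono[OF err, of K] K(1) by linarith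
    qed
    finally show ?thesis using lr(4) by (simp add: k mult_ac)
  qed
  have sums: "u b - u a = (\<Sum>(x,k)\<in>\<D>. u (Sup k) - u (Inf k))" "b - a = (\<Sum>(x,k)\<in>\<D>. Sup k - Inf k)"
    using additive_tagged_division_1[OF ab D(1), of u] additive_tagged_division_1[OF ab D(1), of "\<lambda>x. x"] by auto
  have "n (u b - u a) \<le> (\<Sum>(x,k)\<in>\<D>. n (u (Sup k) - u (Inf k)))"
    unfolding sums using norm_function_sum_le[OF n(1), of "\<lambda>(x,k). u (Sup k) - u (Inf k)" \<D>]
    by (simp add: case_prod_unfold)
  also have "\<dots> \<le> (\<Sum>(x,k)\<in>\<D>. measure lborel k * g x + K * \<eta> * (Sup k - Inf k))"
    by (intro sum_mono) (use piece in auto)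
  also have "\<dots> = ?G + K * \<eta> * (b - a)"
    unfolding sums by (simp add: case_prod_unfold sum.distrib sum_distrib_left)
  also have "?G < integral {a..b} g + e / 2" using \<gamma>(2)[OF D(1,2)] unfolding real_norm_def by linarith
  finally show "n (u b - u a) \<le> integral {a..b} g + e" using small by linarith
qed

text \<open>
  Finitely many exceptional points split the interval into pieces; the end points of a piece are
  approached from inside, by continuity of \<open>u\<close>. This covers the break points of a piecewise smooth
  curve.
\<close>

lemma norm_function_increment_le_integral:
  fixes u :: "real \<Rightarrow> 'e::real_normed_vector"
  assumes n: "norm_function n" "continuous_on UNIV n"
    and S: "finite S" and ab: "a \<le> b" and cont: "continuous_on {a..b} u"
    and u: "\<And>t. t \<in> {a<..<b} - S \<Longrightarrow> (u has_vector_derivative u' t) (at t)"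
    and g: "g integrable_on {a..b}" "\<And>t. t \<in> {a..b} \<Longrightarrow> 0 \<le> g t"
    and le: "\<And>t. t \<in> {a<..<b} - S \<Longrightarrow> n (u' t) \<le> g t"
  shows "n (u b - u a) \<le> integral {a..b} g"
  using S ab cont u g le
proof (induction S arbitrary: a b)
  case empty
  show ?case
  proof (cases "a < b")
    case False
    then show ?thesis using empty.prems(1) norm_function_eq_0[OF n(1), of 0] by simp
  next
    case True
    have inner: "n (u (b - h) - u (a + h)) \<le> integral {a..b} g" if h: "0 < h" "h < (b - a) / 2" for h
    proof -
      have sub: "{a + h..b - h} \<subseteq> {a..b}" "{a + h..b - h} \<subseteq> {a<..<b}" and lt: "a + h \<le> b - h"
        using h by (auto simp: field_simps)
      have gi: "g integrable_on {a + h..b - h}" by (rule integrable_subinterval_real[OF empty.prems(4) sub(1)])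
      have "n (u (b - h) - u (a + h)) \<le> integral {a + h..b - h} g"
        by (rule norm_function_increment_le_integral_closed[OF n lt _ gi, of u u'])
           (use empty.prems(3,6) subsetD[OF sub(2)] in \<open>simp_all add: has_vector_derivative_at_within\<close>)
      also have "\<dots> \<le> integral {a..b} g"
        by (rule integral_subset_le[OF sub(1) gi empty.prems(4)]) (use empty.prems(5) in auto)
      finally show ?thesis .
    qed
    have "((\<lambda>h. n (u (b - h) - u (a + h))) \<longlongrightarrow> n (u (b - 0) - u (a + 0))) (at 0 within {0..b - a})"
    proof -
      have "continuous_on {0..b - a} (\<lambda>h. n (u (b - h) - u (a + h)))"
        by (intro continuous_on_compose2[OF n(2)] continuous_on_diff continuous_on_compose2[OF empty.prems(2)]
              continuous_intros) auto
      then show ?thesis unfolding continuous_on_def by (rule bspec) (use True in simp)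
    qed
    then have lim: "((\<lambda>h. n (u (b - h) - u (a + h))) \<longlongrightarrow> n (u b - u a)) (at_right 0)"
      using True by (simp add: at_within_Icc_at_right)
    have "\<forall>\<^sub>F h in at_right 0. n (u (b - h) - u (a + h)) \<le> integral {a..b} g"
      using inner True by (auto simp: eventually_at_right_field intro!: exI[of _ "(b - a) / 2"])
    with lim show ?thesis by (rule tendsto_upperbound) simp
  qed
next
  case (insert x S)
  show ?case
  proof (cases "x \<in> {a<..<b}")
    case False
    show ?thesis by (rule insert.IH) (use insert.prems False in auto)
  next
    case True
    have gi: "g integrable_on {a..x}" "g integrable_on {x..b}"
      using True by (auto intro!: integrable_subinterval_real[OF insert.prems(4)])
    have "n (u x - u a) \<le> integral {a..x} g"
      by (rule insert.IH) (use insert.prems True gi in \<open>auto intro: continuous_on_subset[OF insert.prems(2)]\<close>)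
    moreover have "n (u b - u x) \<le> integral {x..b} g"
      by (rule insert.IH) (use insert.prems True gi in \<open>auto intro: continuous_on_subset[OF insert.prems(2)]\<close>)
    moreover have "n (u b - u a) \<le> n (u b - u x) + n (u x - u a)"
      using norm_function_triangle[OF n(1), of "u b - u x" "u x - u a"] by simp
    moreover have "integral {a..x} g + integral {x..b} g = integral {a..b} g"
      using True insert.prems(4) by (intro Henstock_Kurzweil_Integration.integral_combine) auto
    ultimately show ?thesis by linarith
  qed
qed

text \<open>
  \<open>h r - r * h 1\<close> vanishes at integers and is additive, hence it has period \<open>1\<close> and is bounded.
  Its value at \<open>m * r\<close> is \<open>m\<close> times its value at \<open>r\<close>, which must therefore be \<open>0\<close>.
\<close>

lemma additive_bounded_imp_linear:
  fixes h :: "real \<Rightarrow> real"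
  assumes add: "\<And>r s. h (r + s) = h r + h s" and bnd: "\<And>r. \<bar>h r\<bar> \<le> C * \<bar>r\<bar>"
  shows "h r = r * h 1"
proof -
  have nat: "h (real m * r) = real m * h r" for m r
  proof (induction m)
    case 0
    then show ?case using add[of 0 0] by simp
  next
    case (Suc m)
    then show ?case using add[of r "real m * r"] by (simp add: algebra_simps)
  qed
  have neg: "h (- r) = - h r" for r
    using add[of r "- r"] add[of 0 0] by simp
  have int: "h (of_int m) = of_int m * h 1" for m
  proof (cases "m \<ge> 0")
    case True
    then show ?thesis using nat[of "nat m" 1] by simp
  next
    case False
    then show ?thesis using nat[of "nat (- m)" 1] neg[of "of_int m"] by simp
  qed
  have "\<bar>h r - r * h 1\<bar> \<le> 0 + e" if "e > 0" for e
  proof -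
    define B where "B = \<bar>C\<bar> + \<bar>h 1\<bar>"
    obtain m :: nat where m: "B / e < real m" using reals_Archimedean2 by blast
    have "B \<ge> 0" by (simp add: B_def)
    then have "real m > 0" using m \<open>e > 0\<close> by (metis divide_nonneg_pos dual_order.strict_trans2)
    define q where "q = frac (real m * r)"
    have q: "0 \<le> q" "q \<le> 1" using frac_lt_1[of "real m * r"] by (auto simp: q_def)
    have "real m * h r = h (of_int \<lfloor>real m * r\<rfloor> + q)"
      by (simp add: nat q_def frac_def)
    also have "\<dots> = of_int \<lfloor>real m * r\<rfloor> * h 1 + h q" by (simp add: add int)
    finally have "real m * (h r - r * h 1) = h q - q * h 1"
      by (simp add: q_def frac_def algebra_simps)
    then have "real m * \<bar>h r - r * h 1\<bar> = \<bar>h q - q * h 1\<bar>"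
      by (metis abs_mult abs_of_nat)
    also have "\<dots> \<le> \<bar>h q\<bar> + \<bar>q\<bar> * \<bar>h 1\<bar>" by (metis abs_mult abs_triangle_ineq4)
    also have "\<dots> \<le> \<bar>C\<bar> * 1 + 1 * \<bar>h 1\<bar>"
    proof (rule add_mono)
      have "\<bar>h q\<bar> \<le> C * \<bar>q\<bar>" by (rule bnd)
      also have "\<dots> \<le> \<bar>C\<bar> * 1" using q by (intro mult_mono) auto
      finally show "\<bar>h q\<bar> \<le> \<bar>C\<bar> * 1" .
    qed (use q in \<open>intro mult_right_mono, auto\<close>)
    also have "\<dots> \<le> real m * e" using m \<open>e > 0\<close> by (simp add: B_def field_simps)
    finally show ?thesis using \<open>real m > 0\<close> by simp
  qed
  then have "\<bar>h r - r * h 1\<bar> \<le> 0" by (rule field_le_epsilon)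
  then show ?thesis by simp
qed

text \<open>
  The Jordan--von Neumann theorem: \<open>B\<close> is obtained by polarization. Additivity is the
  parallelogram law; homogeneity follows from additivity and the Cauchy--Schwarz bound
  \<open>\<bar>B v w\<bar> \<le> n v * n w\<close>, which is a consequence of the triangle inequality.
\<close>

lemma jordan_von_neumann:
  fixes n :: "'e::real_vector \<Rightarrow> real"
  assumes n: "norm_function n"
    and par: "\<And>v w. 2 * (n v)\<^sup>2 + 2 * (n w)\<^sup>2 \<le> (n (v + w))\<^sup>2 + (n (v - w))\<^sup>2"
  obtains B where "\<And>v w. B v w = B w v" "\<And>u v w. B (u + v) w = B u w + B v w"
    "\<And>r v w. B (r *\<^sub>R v) w = r * B v w" "\<And>v. B v v = (n v)\<^sup>2"
proof -
  define B where "B = (\<lambda>v w. ((n (v + w))\<^sup>2 - (n (v - w))\<^sup>2) / 4)"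
  have dbl: "n (v + v) = 2 * n v" for v
    using norm_function_scale[OF n, of 2 v] by (simp add: scaleR_2)
  \<comment> \<open>The inequality for \<open>v + w\<close> and \<open>v - w\<close> is the reverse inequality for \<open>v\<close> and \<open>w\<close>.\<close>
  have eq: "(n (v + w))\<^sup>2 + (n (v - w))\<^sup>2 = 2 * (n v)\<^sup>2 + 2 * (n w)\<^sup>2" for v w
  proof -
    have "2 * (n (v + w))\<^sup>2 + 2 * (n (v - w))\<^sup>2 \<le> (2 * n v)\<^sup>2 + (2 * n w)\<^sup>2"
      using par[of "v + w" "v - w"] dbl[of v] dbl[of w] by (simp add: algebra_simps)
    then show ?thesis using par[of v w] by (simp add: power_mult_distrib)
  qed
  have sym: "B v w = B w v" for v w
    by (simp add: B_def add.commute norm_function_minus_commute[OF n, of v])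
  have zero: "B 0 w = 0" for w by (simp add: B_def norm_function_minus[OF n])
  \<comment> \<open>The parallelogram law for \<open>u + w\<close> and \<open>v\<close> minus the one for \<open>u - w\<close> and \<open>v\<close>.\<close>
  have half: "B (u + v) w + B (u - v) w = 2 * B u w" for u v w
    using eq[of "u + w" v] eq[of "u - w" v] by (simp add: B_def algebra_simps add_divide_distrib diff_divide_distrib)
  have add: "B (u + v) w = B u w + B v w" for u v w
  proof -
    have d: "B (a + a) w = 2 * B a w" for a using half[of a a w] zero[of w] by simp
    have "B (u + v + (u - v)) w + B (u + v - (u - v)) w = 2 * B (u + v) w" by (rule half)
    then have "B (u + u) w + B (v + v) w = 2 * B (u + v) w" by (simp add: algebra_simps)
    then show ?thesis by (simp add: d)
  qed
  have bnd: "\<bar>B v w\<bar> \<le> n v * n w" for v w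
  proof -
    have 1: "n (v + w) \<le> n v + n w" "n (v - w) \<le> n v + n w"
      using norm_function_triangle[OF n, of v w] norm_function_triangle[OF n, of v "- w"]
      by (simp_all add: norm_function_minus[OF n])
    have 2: "\<bar>n v - n w\<bar> \<le> n (v + w)" "\<bar>n v - n w\<bar> \<le> n (v - w)"
      using norm_function_triangle[OF n, of "v + w" "- w"] norm_function_triangle[OF n, of "v + w" "- v"]
        norm_function_triangle[OF n, of "v - w" w] norm_function_triangle[OF n, of "w - v" v]
      by (auto simp: norm_function_minus[OF n] norm_function_minus_commute[OF n, of w v])
    have "(n (v + w))\<^sup>2 \<le> (n v + n w)\<^sup>2" "(n (v - w))\<^sup>2 \<le> (n v + n w)\<^sup>2"
      using 1 norm_function_nonneg[OF n] by (auto intro!: power_mono)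
    moreover have "(n v - n w)\<^sup>2 \<le> (n (v + w))\<^sup>2" "(n v - n w)\<^sup>2 \<le> (n (v - w))\<^sup>2"
      using 2 by (simp_all add: abs_le_square_iff[symmetric] norm_function_nonneg[OF n])
    moreover have "(n v + n w)\<^sup>2 - (n v - n w)\<^sup>2 = 4 * (n v * n w)"
      by (simp add: power2_eq_square algebra_simps)
    ultimately show ?thesis unfolding B_def by (auto simp: abs_le_iff)
  qed
  have scale: "B (r *\<^sub>R v) w = r * B v w" for r v w
  proof -
    have "B (r *\<^sub>R v) w = r * B (1 *\<^sub>R v) w"
    proof (rule additive_bounded_imp_linear)
      show "B ((r + s) *\<^sub>R v) w = B (r *\<^sub>R v) w + B (s *\<^sub>R v) w" for r s
        by (simp add: scaleR_add_left add)
      show "\<bar>B (r *\<^sub>R v) w\<bar> \<le> (n v * n w) * \<bar>r\<bar>" for r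
        using bnd[of "r *\<^sub>R v" w] by (simp add: norm_function_scale[OF n] mult_ac)
    qed
    then show ?thesis by simp
  qed
  have "B v v = (n v)\<^sup>2" for v
    using norm_function_eq_0[OF n, of 0] by (simp add: B_def dbl power_mult_distrib)
  then show thesis using that sym add scale by blast
qed

section \<open>The parallelogram inequality on a grid\<close>

text \<open>
  With \<open>D s t\<close> the distance between the points \<open>s\<close> and \<open>t\<close> of a curve, this is the length of the
  inscribed polygon with \<open>2 ^ m\<close> equal parameter steps.
\<close>

definition dyadic_sum :: "nat \<Rightarrow> (real \<Rightarrow> real \<Rightarrow> real) \<Rightarrow> real" where
  "dyadic_sum m D = (\<Sum>i<2 ^ m. D (real i / 2 ^ m) (real (Suc i) / 2 ^ m))"

lemma le_sum_chain:
  fixes d :: "'a \<Rightarrow> 'a \<Rightarrow> real"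
  assumes "\<And>x. d x x = 0" and "\<And>x y z. d x z \<le> d x y + d y z" and "k \<le> l"
  shows "d (p k) (p l) \<le> (\<Sum>i=k..<l. d (p i) (p (Suc i)))"
  using \<open>k \<le> l\<close>
proof (induction l rule: dec_induct)
  case base
  then show ?case by (simp add: assms(1))
next
  case (step l)
  then show ?case using assms(2)[of "p k" "p (Suc l)" "p l"] by simp
qed

lemma dyadic_sum_mono:
  assumes tri: "\<And>x y z. D x z \<le> D x y + D y z" and "m \<le> m'"
  shows "dyadic_sum m D \<le> dyadic_sum m' D"
proof -
  have "dyadic_sum m D \<le> dyadic_sum (Suc m) D" for m
  proof -
    have "dyadic_sum (Suc m) D = (\<Sum>i<2 ^ m * 2. D (real i / 2 ^ Suc m) (real (Suc i) / 2 ^ Suc m))"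
      by (simp add: dyadic_sum_def mult.commute)
    also have "\<dots> = (\<Sum>i<2 ^ m. \<Sum>j\<in>{i * 2..<i * 2 + 2}. D (real j / 2 ^ Suc m) (real (Suc j) / 2 ^ Suc m))"
      by (rule sum.nat_group[symmetric])
    also have "\<dots> \<ge> dyadic_sum m D" unfolding dyadic_sum_def
    proof (rule sum_mono)
      fix i :: nat
      have eq: "(2 + real i * 2) / (2 * 2 ^ m) = (1 + real i) / 2 ^ m" by (simp add: field_simps)
      have "{i * 2..<i * 2 + 2} = {i * 2, i * 2 + 1}" by auto
      then show "D (real i / 2 ^ m) (real (Suc i) / 2 ^ m)
        \<le> (\<Sum>j\<in>{i * 2..<i * 2 + 2}. D (real j / 2 ^ Suc m) (real (Suc j) / 2 ^ Suc m))"
        using tri[of "real i / 2 ^ m" "real (Suc i) / 2 ^ m" "(real i * 2 + 1) / 2 ^ Suc m"]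
        by (simp add: eq add.commute mult.commute)
    qed
    finally show ?thesis .
  qed
  then show ?thesis using lift_Suc_mono_le[of "\<lambda>m. dyadic_sum m D"] \<open>m \<le> m'\<close> by blast
qed

text \<open>
  Rounding the points of a subdivision down to multiples of \<open>1 / 2 ^ m\<close> changes each summand by at most
  \<open>2 * C / 2 ^ m\<close>, and the dyadic polygon refines the rounded one.
\<close>

lemma dyadic_sum_approximates_length:
  assumes zero: "\<And>x. D x x = 0" and sym: "\<And>x y. D x y = D y x"
    and tri: "\<And>x y z. D x z \<le> D x y + D y z"
    and lip: "\<And>s t. s \<in> {0..1} \<Longrightarrow> t \<in> {0..1} \<Longrightarrow> D s t \<le> C * \<bar>s - t\<bar>"
    and sub: "subdivision 0 1 n \<tau>" and c: "c < (\<Sum>i<n. D (\<tau> i) (\<tau> (Suc i)))"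
  obtains m where "c < dyadic_sum m D"
proof -
  define S where "S = (\<Sum>i<n. D (\<tau> i) (\<tau> (Suc i)))"
  have C: "C \<ge> 0" using lip[of 0 1] tri[of 0 0 1] sym[of 0 1] zero[of 0] by auto
  obtain m :: nat where "2 * real n * C / (S - c) < 2 ^ m"
    using real_arch_pow[of 2] by (metis one_less_numeral_iff semiring_norm(76))
  then have m: "2 * real n * C / 2 ^ m < S - c"
    using c by (simp add: field_simps S_def)
  \<comment> \<open>The points of the subdivision, rounded down to the dyadic grid.\<close>
  define k where "k i = nat \<lfloor>\<tau> i * 2 ^ m\<rfloor>" for i
  have \<tau>: "0 \<le> \<tau> i" "\<tau> i \<le> 1" if "i \<le> n" for i
    using sub that unfolding subdivision_def mono_on_def
    by (metis atMost_iff le0, metis atMost_iff order_refl)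
  have mono: "k i \<le> k j" if "i \<le> j" "j \<le> n" for i j
    using sub that unfolding subdivision_def mono_on_def k_def
    by (intro nat_mono floor_mono mult_right_mono) auto
  have k0: "k 0 = 0" and kn: "k n = 2 ^ m"
    using sub by (auto simp: subdivision_def k_def)
  have close: "\<bar>\<tau> i - real (k i) / 2 ^ m\<bar> \<le> 1 / 2 ^ m" "real (k i) / 2 ^ m \<in> {0..1}" if "i \<le> n" for i
  proof -
    have "real (k i) = of_int \<lfloor>\<tau> i * 2 ^ m\<rfloor>" using \<tau>[OF that] by (simp add: k_def)
    then have *: "real (k i) \<le> \<tau> i * 2 ^ m" "\<tau> i * 2 ^ m \<le> real (k i) + 1" by linarith+
    then have "real (k i) / 2 ^ m \<le> \<tau> i" "\<tau> i \<le> (real (k i) + 1) / 2 ^ m"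
      by (simp_all add: field_simps)
    then show "\<bar>\<tau> i - real (k i) / 2 ^ m\<bar> \<le> 1 / 2 ^ m" "real (k i) / 2 ^ m \<in> {0..1}"
      using \<tau>[OF that] mono[OF that order_refl] by (auto simp: add_divide_distrib kn)
  qed
  have near: "D (\<tau> i) (real (k i) / 2 ^ m) \<le> C / 2 ^ m" if "i \<le> n" for i
  proof -
    have "D (\<tau> i) (real (k i) / 2 ^ m) \<le> C * \<bar>\<tau> i - real (k i) / 2 ^ m\<bar>"
      using lip \<tau>[OF that] close[OF that] by auto
    also have "\<dots> \<le> C * (1 / 2 ^ m)" using close(1)[OF that] C by (rule mult_left_mono)
    finally show ?thesis by simp
  qed
  let ?p = "\<lambda>j. real j / 2 ^ m"
  have "S \<le> (\<Sum>i<n. 2 * C / 2 ^ m + (\<Sum>j=k i..<k (Suc i). D (?p j) (?p (Suc j))))"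
    unfolding S_def
  proof (rule sum_mono)
    fix i assume "i \<in> {..<n}"
    then have i: "i \<le> n" "Suc i \<le> n" by auto
    have "D (\<tau> i) (\<tau> (Suc i)) \<le> D (\<tau> i) (?p (k i)) + (D (?p (k i)) (?p (k (Suc i))) + D (?p (k (Suc i))) (\<tau> (Suc i)))"
      using tri[of "\<tau> i" "\<tau> (Suc i)" "?p (k i)"] tri[of "?p (k i)" "\<tau> (Suc i)" "?p (k (Suc i))"] by linarith
    also have "D (?p (k i)) (?p (k (Suc i))) \<le> (\<Sum>j=k i..<k (Suc i). D (?p j) (?p (Suc j)))"
      using le_sum_chain[of D "k i" "k (Suc i)" ?p] zero tri mono[of i "Suc i"] i by simp
    finally show "D (\<tau> i) (\<tau> (Suc i)) \<le> 2 * C / 2 ^ m + (\<Sum>j=k i..<k (Suc i). D (?p j) (?p (Suc j)))"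
      using near[OF i(1)] near[OF i(2)] sym[of "\<tau> (Suc i)"] by simp
  qed
  also have "\<dots> = 2 * real n * C / 2 ^ m + (\<Sum>i<n. \<Sum>j=k i..<k (Suc i). D (?p j) (?p (Suc j)))"
    by (simp add: sum.distrib)
  also have "(\<Sum>i<n'. \<Sum>j=k i..<k (Suc i). D (?p j) (?p (Suc j))) = (\<Sum>j=0..<k n'. D (?p j) (?p (Suc j)))"
    if "n' \<le> n" for n'
    using that
  proof (induction n')
    case (Suc n')
    then show ?case
      using sum.atLeastLessThan_concat[of 0 "k n'" "k (Suc n')" "\<lambda>j. D (?p j) (?p (Suc j))"]
        mono[of n' "Suc n'"] by simp
  qed (simp add: k0)
  from this[of n] have "(\<Sum>i<n. \<Sum>j=k i..<k (Suc i). D (?p j) (?p (Suc j))) = dyadic_sum m D"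
    by (simp add: kn dyadic_sum_def lessThan_atLeast0)
  finally show thesis using m by (intro that[of m]) simp
qed

text \<open>
  One half of Dini's theorem: the open sets on which \<open>S m\<close> exceeds \<open>c\<close> increase with \<open>m\<close> and cover the
  compact set \<open>K\<close>, so one of them is everything.
\<close>

lemma dini_lower_bound:
  fixes S :: "nat \<Rightarrow> 'a::topological_space \<Rightarrow> real"
  assumes "compact K" and cont: "\<And>m. continuous_on K (S m)"
    and mono: "\<And>m m' x. x \<in> K \<Longrightarrow> m \<le> m' \<Longrightarrow> S m x \<le> S m' x"
    and ex: "\<And>x. x \<in> K \<Longrightarrow> \<exists>m. c < S m x"
  obtains m where "\<And>m' x. x \<in> K \<Longrightarrow> m \<le> m' \<Longrightarrow> c < S m' x"
proof -
  have "\<exists>U. open U \<and> U \<inter> K = S m -` {c<..} \<inter> K" for m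
    using cont[of m] open_greaterThan unfolding continuous_on_open_invariant by blast
  then obtain U where U: "\<And>m. open (U m)" "\<And>m. U m \<inter> K = S m -` {c<..} \<inter> K" by metis
  have "K \<subseteq> (\<Union>m\<in>UNIV. U m)" using ex U(2) by blast
  then obtain F where F: "finite F" "K \<subseteq> (\<Union>m\<in>F. U m)"
    by (rule compactE_image[OF \<open>compact K\<close> U(1)])
  show thesis
  proof (rule that[of "Max (insert 0 F)"])
    fix m' x assume x: "x \<in> K" "Max (insert 0 F) \<le> m'"
    then obtain m where m: "m \<in> F" "x \<in> U m" using F by auto
    then have "c < S m x" using U(2)[of m] x by auto
    also have "\<dots> \<le> S m' x" using F(1) m(1) x by (intro mono) (auto intro: order_trans[OF Max_ge])
    finally show "c < S m' x" .
  qed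
qed

lemma grid_cauchy_schwarz:
  fixes c :: real and M :: nat
  assumes "M > 0" "0 \<le> c" and row: "\<And>j. j < M \<Longrightarrow> c \<le> (\<Sum>i<M. x i j)"
  shows "c\<^sup>2 \<le> (\<Sum>j<M. \<Sum>i<M. (x i j)\<^sup>2)"
proof -
  have "c\<^sup>2 / real M \<le> (\<Sum>i<M. (x i j)\<^sup>2)" if "j < M" for j
  proof -
    have "c\<^sup>2 \<le> (\<Sum>i<M. x i j)\<^sup>2" using row[OF that] \<open>0 \<le> c\<close> by (intro power_mono)
    also have "\<dots> \<le> (\<Sum>i<M. (x i j)\<^sup>2) * real M"
      using sum_squared_le_sum_of_squares[of "\<lambda>i. x i j" "{..<M}"] by simp
    finally show ?thesis using \<open>M > 0\<close> by (simp add: field_simps)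
  qed
  then have "(\<Sum>j<M. c\<^sup>2 / real M) \<le> (\<Sum>j<M. \<Sum>i<M. (x i j)\<^sup>2)" by (intro sum_mono) auto
  then show ?thesis using \<open>M > 0\<close> by simp
qed

text \<open>
  The heart of the proof. Here \<open>D x y\<close> is the distance of the images of \<open>x\<close> and \<open>y\<close> under a map into a
  space with the quadrilateral inequality; \<open>upper\<close> is a Lipschitz bound and \<open>lower\<close> bounds the lengths
  of images of segments from below. The parallelogram \<open>x0 + s v + t w\<close> is divided into \<open>M\<^sup>2\<close> cells with
  \<open>M = 2 ^ m\<close>. In the cell \<open>(i, j)\<close> the points with coordinates \<open>l i\<close> or \<open>l (Suc i)\<close> and \<open>c j\<close>,
  and \<open>c i\<close> and \<open>l j\<close> or \<open>l (Suc j)\<close>, are the midpoints of the sides of the cell. They span a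
  quadrilateral with diagonals \<open>x i j\<close> and \<open>y i j\<close> and sides at most \<open>C n (v \<plusminus> w) / 2M\<close>. The sums of
  the \<open>x i j\<close> along rows and of the \<open>y i j\<close> along columns are dyadic sums, hence at least \<open>a\<close> and \<open>b\<close>.
\<close>

lemma parallelogram_estimate:
  fixes D :: "'e::real_normed_vector \<Rightarrow> 'e \<Rightarrow> real"
  assumes n: "norm_function n" and n_cont: "continuous_on UNIV n"
    and nonneg: "\<And>x y. D x y \<ge> 0"
    and zero: "\<And>x. D x x = 0" and sym: "\<And>x y. D x y = D y x"
    and tri: "\<And>x y z. D x z \<le> D x y + D y z"
    and quad: "\<And>a b c d. (D a c)\<^sup>2 + (D b d)\<^sup>2 \<le> (D a b)\<^sup>2 + (D b c)\<^sup>2 + (D c d)\<^sup>2 + (D d a)\<^sup>2"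
    and Q: "\<And>s t. s \<in> {0..1} \<Longrightarrow> t \<in> {0..1} \<Longrightarrow> x0 + s *\<^sub>R v + t *\<^sub>R w \<in> Q"
    and upper: "\<And>x y. x \<in> Q \<Longrightarrow> y \<in> Q \<Longrightarrow> D x y \<le> C * n (y - x)"
    and lower: "\<And>x y c. x \<in> Q \<Longrightarrow> y \<in> Q \<Longrightarrow> c < \<mu> * n (y - x) \<Longrightarrow>
       \<exists>k \<tau>. subdivision 0 1 k \<tau> \<and> c < (\<Sum>i<k. D (x + \<tau> i *\<^sub>R (y - x)) (x + \<tau> (Suc i) *\<^sub>R (y - x)))"
    and a: "0 \<le> a" "a < \<mu> * n v" and b: "0 \<le> b" "b < \<mu> * n w"
    and C: "C \<ge> 0"
  shows "2 * (a\<^sup>2 + b\<^sup>2) \<le> C\<^sup>2 * ((n (v + w))\<^sup>2 + (n (v - w))\<^sup>2)"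
proof -
  let ?P = "\<lambda>s t. x0 + s *\<^sub>R v + t *\<^sub>R w"
  define X where "X s = (\<lambda>r r'. D (?P r s) (?P r' s))" for s
  define Y where "Y s = (\<lambda>r r'. D (?P s r) (?P s r'))" for s
  \<comment> \<open>By \<open>upper\<close>, \<open>D\<close> is continuous, so the dyadic sums depend continuously on the offset of the line.\<close>
  have D_cont: "continuous_on {0..1} (\<lambda>s. D (g s) (h s))"
    if g: "\<And>s. s \<in> {0..1} \<Longrightarrow> g s \<in> Q" "continuous_on {0..1} g"
      and h: "\<And>s. s \<in> {0..1} \<Longrightarrow> h s \<in> Q" "continuous_on {0..1} h" for g h :: "real \<Rightarrow> 'e"
    unfolding continuous_on_def
  proof
    fix s :: real assume s: "s \<in> {0..1}"
    have n0: "((\<lambda>t. n (g t - g s)) \<longlongrightarrow> 0) (at s within {0..1})" "((\<lambda>t. n (h t - h s)) \<longlongrightarrow> 0) (at s within {0..1})"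
    proof -
      have "continuous_on {0..1} (\<lambda>t. n (g t - g s))" "continuous_on {0..1} (\<lambda>t. n (h t - h s))"
        by (intro continuous_on_compose2[OF n_cont] continuous_intros g h subset_UNIV)+
      then show "((\<lambda>t. n (g t - g s)) \<longlongrightarrow> 0) (at s within {0..1})" "((\<lambda>t. n (h t - h s)) \<longlongrightarrow> 0) (at s within {0..1})"
        using s norm_function_eq_0[OF n, of 0] unfolding continuous_on_def by fastforce+
    qed
    have "((\<lambda>t. C * n (g t - g s) + C * n (h t - h s)) \<longlongrightarrow> C * 0 + C * 0) (at s within {0..1})"
      by (intro tendsto_intros n0)
    then have lim: "((\<lambda>t. C * n (g t - g s) + C * n (h t - h s)) \<longlongrightarrow> 0) (at s within {0..1})" by simp
    have "\<bar>D (g t) (h t) - D (g s) (h s)\<bar> \<le> C * n (g t - g s) + C * n (h t - h s)" if t: "t \<in> {0..1}" for t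
    proof -
      have "\<bar>D (g t) (h t) - D (g s) (h s)\<bar> \<le> D (g s) (g t) + D (h s) (h t)"
        using tri[of "g t" "h t" "g s"] tri[of "g s" "h t" "h s"] tri[of "g s" "h s" "g t"] tri[of "g t" "h s" "h t"]
          sym[of "g t" "g s"] sym[of "h t" "h s"] by linarith
      also have "\<dots> \<le> C * n (g t - g s) + C * n (h t - h s)" using s t g h by (intro add_mono upper) auto
      finally show ?thesis .
    qed
    then have "((\<lambda>t. D (g t) (h t) - D (g s) (h s)) \<longlongrightarrow> 0) (at s within {0..1})"
      by (intro Lim_null_comparison[OF _ lim]) (simp add: eventually_at_filter)
    then show "((\<lambda>t. D (g t) (h t)) \<longlongrightarrow> D (g s) (h s)) (at s within {0..1})"
      by (simp add: LIM_zero_iff)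
  qed
  have frac: "real i / 2 ^ m \<in> {0..1}" if "i \<le> 2 ^ m" for i m
    using that by (metis atLeastAtMost_iff divide_le_eq_1_pos divide_nonneg_pos of_nat_0_le_iff of_nat_le_iff of_nat_numeral of_nat_power zero_less_numeral zero_less_power)
  have S_cont: "continuous_on {0..1} (\<lambda>s. dyadic_sum m (X s))" "continuous_on {0..1} (\<lambda>s. dyadic_sum m (Y s))" for m
    unfolding dyadic_sum_def X_def Y_def
    by (intro continuous_on_sum D_cont Q continuous_intros frac; simp)+
  have exX: "\<exists>m. a < dyadic_sum m (X s)" if s: "s \<in> {0..1}" for s
  proof -
    obtain k \<tau> where \<tau>: "subdivision 0 1 k \<tau>"
      "a < (\<Sum>i<k. D (?P 0 s + \<tau> i *\<^sub>R (?P 1 s - ?P 0 s)) (?P 0 s + \<tau> (Suc i) *\<^sub>R (?P 1 s - ?P 0 s)))"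
      using lower[of "?P 0 s" "?P 1 s" a] Q[of 0 s] Q[of 1 s] s a by auto
    have "\<exists>m. a < dyadic_sum m (X s)"
    proof (rule dyadic_sum_approximates_length[of "X s" "C * n v", OF _ _ _ _ \<tau>(1)])
      show "X s r t \<le> C * n v * \<bar>r - t\<bar>" if "r \<in> {0..1}" "t \<in> {0..1}" for r t
      proof -
        have "X s r t \<le> C * n (?P t s - ?P r s)" unfolding X_def by (intro upper Q that s)
        also have "?P t s - ?P r s = (t - r) *\<^sub>R v" by (simp add: algebra_simps)
        finally show ?thesis by (simp add: norm_function_scale[OF n] mult_ac abs_minus_commute)
      qed
      show "a < (\<Sum>i<k. X s (\<tau> i) (\<tau> (Suc i)))"
        using \<tau>(2) by (simp add: X_def add_ac)
    qed (auto simp: X_def zero tri intro: sym)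
    then show ?thesis .
  qed
  have exY: "\<exists>m. b < dyadic_sum m (Y s)" if s: "s \<in> {0..1}" for s
  proof -
    obtain k \<tau> where \<tau>: "subdivision 0 1 k \<tau>"
      "b < (\<Sum>i<k. D (?P s 0 + \<tau> i *\<^sub>R (?P s 1 - ?P s 0)) (?P s 0 + \<tau> (Suc i) *\<^sub>R (?P s 1 - ?P s 0)))"
      using lower[of "?P s 0" "?P s 1" b] Q[of s 0] Q[of s 1] s b by auto
    have "\<exists>m. b < dyadic_sum m (Y s)"
    proof (rule dyadic_sum_approximates_length[of "Y s" "C * n w", OF _ _ _ _ \<tau>(1)])
      show "Y s r t \<le> C * n w * \<bar>r - t\<bar>" if "r \<in> {0..1}" "t \<in> {0..1}" for r t
      proof -
        have "Y s r t \<le> C * n (?P s t - ?P s r)" unfolding Y_def by (intro upper Q that s)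
        also have "?P s t - ?P s r = (t - r) *\<^sub>R w" by (simp add: algebra_simps)
        finally show ?thesis by (simp add: norm_function_scale[OF n] mult_ac abs_minus_commute)
      qed
      show "b < (\<Sum>i<k. Y s (\<tau> i) (\<tau> (Suc i)))"
        using \<tau>(2) by (simp add: Y_def add_ac)
    qed (auto simp: Y_def zero tri intro: sym)
    then show ?thesis .
  qed
  obtain m1 where m1: "\<And>m s. s \<in> {0..1} \<Longrightarrow> m1 \<le> m \<Longrightarrow> a < dyadic_sum m (X s)"
    by (rule dini_lower_bound[of "{0..1::real}" "\<lambda>m s. dyadic_sum m (X s)" a])
       (use S_cont exX in \<open>auto intro: dyadic_sum_mono simp: X_def tri\<close>)
  obtain m2 where m2: "\<And>m s. s \<in> {0..1} \<Longrightarrow> m2 \<le> m \<Longrightarrow> b < dyadic_sum m (Y s)"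
    by (rule dini_lower_bound[of "{0..1::real}" "\<lambda>m s. dyadic_sum m (Y s)" b])
       (use S_cont exY in \<open>auto intro: dyadic_sum_mono simp: Y_def tri\<close>)
  define m where "m = max m1 m2"
  define M :: nat where "M = 2 ^ m"
  have M: "M > 0" "real M = 2 ^ m" by (simp_all add: M_def)
  \<comment> \<open>Grid points \<open>l i\<close> and midpoints \<open>c i\<close> between them.\<close>
  define l where "l i = real i / real M" for i
  define c where "c i = (real i + 1/2) / real M" for i
  have l: "l i \<in> {0..1}" if "i \<le> M" for i using that M by (simp add: l_def)
  have c: "c i \<in> {0..1}" if "i < M" for i using that by (simp add: c_def field_simps)
  define x where "x i j = D (?P (l i) (c j)) (?P (l (Suc i)) (c j))" for i j
  define y where "y i j = D (?P (c i) (l j)) (?P (c i) (l (Suc j)))" for i j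
  have "a \<le> (\<Sum>i<M. x i j)" if "j < M" for j
    using m1[OF c[OF that], of m] by (simp add: dyadic_sum_def X_def x_def l_def M_def m_def)
  then have sx: "a\<^sup>2 \<le> (\<Sum>j<M. \<Sum>i<M. (x i j)\<^sup>2)" using M a by (intro grid_cauchy_schwarz) auto
  have "b \<le> (\<Sum>j<M. y i j)" if "i < M" for i
    using m2[OF c[OF that], of m] by (simp add: dyadic_sum_def Y_def y_def l_def M_def m_def)
  then have "b\<^sup>2 \<le> (\<Sum>i<M. \<Sum>j<M. (y i j)\<^sup>2)" using M b by (intro grid_cauchy_schwarz) auto
  also have "\<dots> = (\<Sum>j<M. \<Sum>i<M. (y i j)\<^sup>2)" by (rule sum.swap)
  finally have sy: "b\<^sup>2 \<le> (\<Sum>j<M. \<Sum>i<M. (y i j)\<^sup>2)" .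
  define K where "K = C\<^sup>2 * ((n (v + w))\<^sup>2 + (n (v - w))\<^sup>2) / (2 * (real M)\<^sup>2)"
  have cell: "(x i j)\<^sup>2 + (y i j)\<^sup>2 \<le> K" if ij: "i < M" "j < M" for i j
  proof -
    have side: "(D (?P s t) (?P s' t'))\<^sup>2 \<le> C\<^sup>2 * (n z)\<^sup>2 / (2 * real M)\<^sup>2"
      if "s \<in> {0..1}" "t \<in> {0..1}" "s' \<in> {0..1}" "t' \<in> {0..1}"
        "?P s' t' - ?P s t = (1 / (2 * real M)) *\<^sub>R z" for s t s' t' z
    proof -
      have "D (?P s t) (?P s' t') \<le> C * n (?P s' t' - ?P s t)" by (intro upper Q that)
      also have "\<dots> = C * n z / (2 * real M)"
        unfolding that(5) by (simp add: norm_function_scale[OF n])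
      finally show ?thesis
        using power_mono[OF _ nonneg, of _ _ _ 2] by (metis power_divide power_mult_distrib)
    qed
    have step: "c i - l i = 1 / (2 * real M)" "l (Suc i) - c i = 1 / (2 * real M)" for i
      using M(1) by (simp_all add: c_def l_def field_simps)
    have L: "l i \<in> {0..1}" "l (Suc i) \<in> {0..1}" "l j \<in> {0..1}" "l (Suc j) \<in> {0..1}" "c i \<in> {0..1}" "c j \<in> {0..1}"
      using ij by (auto intro!: l c simp del: atLeastAtMost_iff)
    have diff: "?P s' t' - ?P s t = (s' - s) *\<^sub>R v + (t' - t) *\<^sub>R w" for s t s' t'
      by (simp add: algebra_simps)
    have neg: "l i - c i = - (1 / (2 * real M))" "c i - l (Suc i) = - (1 / (2 * real M))" for i
      using step[of i] by linarith+
    have 1: "(D (?P (l i) (c j)) (?P (c i) (l j)))\<^sup>2 \<le> C\<^sup>2 * (n (v - w))\<^sup>2 / (2 * real M)\<^sup>2"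
      by (rule side) (use L in \<open>simp_all only: diff step neg, simp add: algebra_simps\<close>)
    have 2: "(D (?P (c i) (l j)) (?P (l (Suc i)) (c j)))\<^sup>2 \<le> C\<^sup>2 * (n (v + w))\<^sup>2 / (2 * real M)\<^sup>2"
      by (rule side) (use L in \<open>simp_all only: diff step neg, simp add: algebra_simps\<close>)
    have 3: "(D (?P (l (Suc i)) (c j)) (?P (c i) (l (Suc j))))\<^sup>2 \<le> C\<^sup>2 * (n (w - v))\<^sup>2 / (2 * real M)\<^sup>2"
      by (rule side) (use L in \<open>simp_all only: diff step neg, simp add: algebra_simps\<close>)
    have 4: "(D (?P (c i) (l (Suc j))) (?P (l i) (c j)))\<^sup>2 \<le> C\<^sup>2 * (n (- v - w))\<^sup>2 / (2 * real M)\<^sup>2"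
      by (rule side) (use L in \<open>simp_all only: diff step neg, simp add: algebra_simps\<close>)
    have nn: "n (w - v) = n (v - w)" "n (- v - w) = n (v + w)"
      using norm_function_minus_commute[OF n, of v w] norm_function_minus[OF n, of "v + w"] by auto
    have "(x i j)\<^sup>2 + (y i j)\<^sup>2 \<le> 2 * (C\<^sup>2 * (n (v + w))\<^sup>2 / (2 * real M)\<^sup>2) + 2 * (C\<^sup>2 * (n (v - w))\<^sup>2 / (2 * real M)\<^sup>2)"
      using quad[of "?P (l i) (c j)" "?P (l (Suc i)) (c j)" "?P (c i) (l j)" "?P (c i) (l (Suc j))"] 1 2 3 4
      unfolding x_def y_def nn by linarith
    also have "\<dots> = K" using M(1) by (simp add: K_def field_simps power2_eq_square)
    finally show ?thesis .
  qed
  have "a\<^sup>2 + b\<^sup>2 \<le> (\<Sum>j<M. \<Sum>i<M. (x i j)\<^sup>2 + (y i j)\<^sup>2)" using sx sy by (simp add: sum.distrib)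
  also have "\<dots> \<le> (\<Sum>j<M. \<Sum>i<M. K)" by (intro sum_mono cell) auto
  also have "\<dots> = C\<^sup>2 * ((n (v + w))\<^sup>2 + (n (v - w))\<^sup>2) / 2"
    using M(1) by (simp add: K_def power2_eq_square)
  finally show ?thesis by simp
qed

section \<open>Smooth curves in a normed space\<close>

lemma smooth_on_imp_C1:
  assumes "smooth_on S f"
  obtains f' where "\<And>x. x \<in> S \<Longrightarrow> (f has_derivative f' x) (at x within S)"
    "\<And>v. continuous_on S (\<lambda>x. f' x v)"
proof -
  have "times_cont_diff_on (Suc 0) S f" using assms unfolding smooth_on_def by blast
  then show thesis using that by auto
qed

lemma smooth_on_cong:
  assumes "smooth_on S f" and eq: "\<And>x. x \<in> S \<Longrightarrow> f x = g x"
  shows "smooth_on S g"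
  unfolding smooth_on_def
proof
  fix k
  have f: "times_cont_diff_on k S f" using assms(1) by (simp add: smooth_on_def)
  show "times_cont_diff_on k S g"
  proof (cases k)
    case 0
    then have "continuous_on S f" using f by simp
    then have "continuous_on S g" by (rule continuous_on_eq) (rule eq)
    then show ?thesis using 0 by simp
  next
    case (Suc k')
    then obtain f' where f': "\<And>x. x \<in> S \<Longrightarrow> (f has_derivative f' x) (at x within S)"
      "\<And>v. times_cont_diff_on k' S (\<lambda>x. f' x v)" using f by auto
    have "(g has_derivative f' x) (at x within S)" if "x \<in> S" for x
      by (rule has_derivative_transform[OF that _ f'(1)[OF that]]) (simp add: eq)
    then show ?thesis using f'(2) unfolding Suc times_cont_diff_on.simps by fast
  qed
qed

text \<open>
  The coordinate segments must be smooth curves in every chart of the atlas, in order to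
  compete in the infimum that defines the Finsler distance.
\<close>

lemma smooth_on_compose_line:
  fixes f :: "'e::real_normed_vector \<Rightarrow> 'f::real_normed_vector"
  assumes "smooth_on T f" and S: "\<And>t. t \<in> S \<Longrightarrow> x + t *\<^sub>R v \<in> T"
  shows "smooth_on S (\<lambda>t. f (x + t *\<^sub>R v))"
proof -
  have "times_cont_diff_on k T f \<Longrightarrow> times_cont_diff_on k S (\<lambda>t. f (x + t *\<^sub>R v))" for k
  proof (induction k arbitrary: f)
    case 0
    then have "continuous_on T f" by simp
    then have "continuous_on S (\<lambda>t. f (x + t *\<^sub>R v))"
      by (rule continuous_on_compose2) (use S in \<open>auto intro!: continuous_intros\<close>)
    then show ?case by simp
  next
    case (Suc k)
    then obtain f' where f': "\<And>x. x \<in> T \<Longrightarrow> (f has_derivative f' x) (at x within T)"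
      "\<And>v. times_cont_diff_on k T (\<lambda>x. f' x v)" by auto
    have "((\<lambda>t. f (x + t *\<^sub>R v)) has_derivative (\<lambda>s. f' (x + t *\<^sub>R v) (s *\<^sub>R v))) (at t within S)"
      if "t \<in> S" for t
      by (rule has_derivative_in_compose2[where t = T, OF f'(1)])
         (use S that in \<open>auto intro!: derivative_eq_intros\<close>)
    moreover have "times_cont_diff_on k S (\<lambda>t. f' (x + t *\<^sub>R v) (s *\<^sub>R v))" for s
      by (rule Suc.IH[OF f'(2)])
    ultimately show ?case unfolding times_cont_diff_on.simps by fast
  qed
  then show ?thesis using assms(1) unfolding smooth_on_def by blast
qed

text \<open>
  Uniqueness of one-sided derivatives, here for values in any real normed space, in particular in the
  model space of a manifold.
\<close>

lemma vector_derivative_Icc: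
  fixes f :: "real \<Rightarrow> 'b::real_normed_vector"
  assumes "a < b" "t \<in> {a..b}" and f: "(f has_vector_derivative f') (at t within {a..b})"
  shows "vector_derivative f (at t within {a..b}) = f'"
  by (rule vector_derivative_within[OF _ f]) (use assms in \<open>simp add: trivial_limit_within\<close>)

lemma curve_stays_near:
  fixes \<gamma> :: "real \<Rightarrow> 'a::topological_space"
  assumes "continuous_on J \<gamma>" "t \<in> J" "open W" "\<gamma> t \<in> W"
  obtains d where "d > 0" "\<And>s. s \<in> J \<Longrightarrow> dist s t < d \<Longrightarrow> \<gamma> s \<in> W"
proof -
  have "(\<gamma> \<longlongrightarrow> \<gamma> t) (at t within J)" using assms(1,2) unfolding continuous_on_def by blast
  then have "\<forall>\<^sub>F s in at t within J. \<gamma> s \<in> W" 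
    by (rule topological_tendstoD[OF _ assms(3,4)])
  then obtain d where d: "d > 0" "\<And>s. s \<in> J \<Longrightarrow> s \<noteq> t \<and> dist s t < d \<Longrightarrow> \<gamma> s \<in> W"
    unfolding eventually_at by blast
  show thesis by (rule that[OF d(1)]) (use d(2) assms(4) in blast)
qed

text \<open>
  Smoothness of a curve in a chart speaks of the parameters that the curve maps into the chart domain,
  velocities speak of the whole parameter interval. Both give the same derivatives, since the former set
  is relatively open.
\<close>

lemma at_within_open_preimage:
  fixes \<gamma> :: "real \<Rightarrow> 'a::topological_space"
  assumes "continuous_on J \<gamma>" "t \<in> J" "open W" "\<gamma> t \<in> W"
  shows "at t within {s \<in> J. \<gamma> s \<in> W} = at t within J"
proof -
  obtain d where "d > 0" "\<And>s. s \<in> J \<Longrightarrow> dist s t < d \<Longrightarrow> \<gamma> s \<in> W"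
    using curve_stays_near[OF assms] by blast
  then show ?thesis
    by (intro at_within_nhd[of t "ball t d"]) (auto simp: dist_commute)
qed

section \<open>Charts and tangent spaces\<close>

context smooth_manifold
begin

lemma chartD:
  assumes "c \<in> A"
  shows "open (fst c)" "open (snd c ` fst c)"
    "homeomorphism (fst c) (snd c ` fst c) (snd c) (inv_into (fst c) (snd c))"
  using chart[of "fst c" "snd c"] assms by simp_all

lemma chart_inverse [simp]:
  assumes "c \<in> A"
  shows "q \<in> fst c \<Longrightarrow> inv_into (fst c) (snd c) (snd c q) = q"
    and "x \<in> snd c ` fst c \<Longrightarrow> snd c (inv_into (fst c) (snd c) x) = x"
    and "x \<in> snd c ` fst c \<Longrightarrow> inv_into (fst c) (snd c) x \<in> fst c"
  by (rule homeomorphism_apply1[OF chartD(3)[OF assms]], assumption)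
     (rule homeomorphism_apply2[OF chartD(3)[OF assms]], assumption, rule inv_into_into)

lemma open_chart_image:
  assumes "c \<in> A" "open W"
  shows "open (snd c ` (fst c \<inter> W))"
proof -
  have "openin (top_of_set (snd c ` fst c)) (snd c ` (fst c \<inter> W))"
    using homeomorphism_imp_open_map[OF chartD(3)[OF assms(1)]] assms(2) by blast
  then show ?thesis using chartD(2)[OF assms(1)] openin_open_trans by blast
qed

lemma charts_atD: "c \<in> charts_at A p \<Longrightarrow> c \<in> A \<and> p \<in> fst c"
  by (simp add: charts_at_def)

lemma charts_at_nonempty: "\<exists>c. c \<in> charts_at A p"
proof -
  have "p \<in> (\<Union>c\<in>A. fst c)" unfolding cover by (rule UNIV_I)
  then show ?thesis unfolding charts_at_def by blast
qed

lemma transition_chart: "c \<in> A \<Longrightarrow> q \<in> fst c \<Longrightarrow> transition c c' (snd c q) = snd c' q"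
  by (simp add: transition_def)

lemma transition_has_derivative:
  assumes c: "c \<in> charts_at A p" and c': "c' \<in> charts_at A p"
  shows "(transition c c' has_derivative transition_deriv c c' p) (at (snd c p))"
proof -
  let ?W = "snd c ` (fst c \<inter> fst c')"
  have W: "open ?W" "snd c p \<in> ?W"
    using open_chart_image chartD(1) charts_atD[OF c] charts_atD[OF c'] by auto
  obtain f' where "\<And>x. x \<in> ?W \<Longrightarrow> (transition c c' has_derivative f' x) (at x within ?W)"
    using compatible[of c c'] charts_atD[OF c] charts_atD[OF c'] by (metis smooth_on_imp_C1)
  then have "transition c c' differentiable at (snd c p)"
    using at_within_open[OF W(2,1)] W(2) unfolding differentiable_def by metis
  then show ?thesis unfolding transition_deriv_def by (simp add: frechet_derivative_works)
qed

lemma transition_deriv_linear: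
  assumes "c \<in> charts_at A p" "c' \<in> charts_at A p"
  shows "linear (transition_deriv c c' p)"
  using has_derivative_linear[OF transition_has_derivative[OF assms]] .

text \<open>
  The chain rule: \<open>transition c' c'' \<circ> transition c c' = transition c c''\<close> near the coordinates of \<open>p\<close>.
\<close>

lemma transition_deriv_cocycle:
  assumes c: "c \<in> charts_at A p" "c' \<in> charts_at A p" "c'' \<in> charts_at A p"
  shows "transition_deriv c' c'' p (transition_deriv c c' p \<xi>) = transition_deriv c c'' p \<xi>"
proof -
  have at: "transition c c' (snd c p) = snd c' p" using c charts_atD transition_chart by metis
  have "(transition c' c'' \<circ> transition c c' has_derivative transition_deriv c' c'' p \<circ> transition_deriv c c' p)
      (at (snd c p))"
    using diff_chain_at[OF transition_has_derivative[OF c(1,2)], of "transition c' c''"]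
      transition_has_derivative[OF c(2,3)] unfolding at by blast
  moreover have "open (snd c ` (fst c \<inter> fst c'))" "snd c p \<in> snd c ` (fst c \<inter> fst c')"
    using open_chart_image chartD(1) c[THEN charts_atD] by auto
  moreover have "(transition c' c'' \<circ> transition c c') x = transition c c'' x"
    if "x \<in> snd c ` (fst c \<inter> fst c')" for x
    using that c[THEN charts_atD] by (auto simp: transition_chart)
  ultimately have "(transition c c'' has_derivative transition_deriv c' c'' p \<circ> transition_deriv c c' p)
      (at (snd c p))"
    by (metis (no_types, lifting) has_derivative_transform_within_open)
  then show ?thesis
    using has_derivative_unique[OF transition_has_derivative[OF c(1,3)]] by (metis comp_apply)
qed

lemma transition_deriv_same:
  assumes c: "c \<in> charts_at A p"
  shows "transition_deriv c c p \<xi> = \<xi>"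
proof -
  have "open (snd c ` fst c)" "snd c p \<in> snd c ` fst c" using chartD(2) charts_atD[OF c] by auto
  moreover have "id x = transition c c x" if "x \<in> snd c ` fst c" for x
    using that charts_atD[OF c] by (auto simp: transition_chart)
  ultimately have "(transition c c has_derivative id) (at (snd c p))"
    using has_derivative_transform_within_open[OF has_derivative_id] by (metis eq_id_iff)
  then show ?thesis
    using has_derivative_unique[OF transition_has_derivative[OF c c]] by simp
qed

lemma tangent_vector_in_tangent_space:
  assumes "c \<in> charts_at A p"
  shows "tangent_vector A c p \<xi> \<in> tangent_space A p"
  using assms by (auto simp: tangent_space_def tangent_vector_def transition_deriv_cocycle)

lemma tangent_vector_coord: "c \<in> charts_at A p \<Longrightarrow> tangent_vector A c p \<xi> c = \<xi>"
  by (simp add: tangent_vector_def transition_deriv_same)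

lemma tangent_vector_of_coord:
  assumes "c \<in> charts_at A p" "v \<in> tangent_space A p"
  shows "tangent_vector A c p (v c) = v"
proof
  fix c'
  have "v c' = transition_deriv c c' p (v c)" if "c' \<in> charts_at A p"
    using assms that unfolding tangent_space_def by blast
  moreover have "v c' = 0" if "c' \<notin> charts_at A p"
    using assms that unfolding tangent_space_def by blast
  ultimately show "tangent_vector A c p (v c) c' = v c'"
    unfolding tangent_vector_def by presburger
qed

lemma tangent_vector_add:
  assumes "c \<in> charts_at A p"
  shows "tangent_vector A c p (\<xi> + \<eta>) = (\<lambda>c'. tangent_vector A c p \<xi> c' + tangent_vector A c p \<eta> c')"
proof
  fix c'
  show "tangent_vector A c p (\<xi> + \<eta>) c' = tangent_vector A c p \<xi> c' + tangent_vector A c p \<eta> c'"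
    using linear_add[OF transition_deriv_linear[OF assms, of c'], of \<xi> \<eta>] by (simp add: tangent_vector_def)
qed

lemma tangent_vector_scale:
  assumes "c \<in> charts_at A p"
  shows "tangent_vector A c p (r *\<^sub>R \<xi>) = (\<lambda>c'. r *\<^sub>R tangent_vector A c p \<xi> c')"
proof
  fix c'
  show "tangent_vector A c p (r *\<^sub>R \<xi>) c' = r *\<^sub>R tangent_vector A c p \<xi> c'"
    using linear_scale[OF transition_deriv_linear[OF assms, of c'], of r \<xi>] by (simp add: tangent_vector_def)
qed

lemma smooth_curve_velocity:
  assumes ab: "a < b" and cont: "continuous_on {a..b} \<gamma>" and sm: "smooth_curve_on A {a..b} \<gamma>"
    and t: "t \<in> {a..b}" and c: "c \<in> charts_at A (\<gamma> t)"
  shows "(snd c \<circ> \<gamma> has_vector_derivative velocity A a b \<gamma> t c) (at t within {a..b})"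
proof -
  let ?J = "{s \<in> {a..b}. \<gamma> s \<in> fst c}"
  have cA: "c \<in> A" "\<gamma> t \<in> fst c" using charts_atD[OF c] by auto
  then have "smooth_on ?J (snd c \<circ> \<gamma>)" using sm by (auto simp: smooth_curve_on_def)
  then obtain f' where "\<And>s. s \<in> ?J \<Longrightarrow> (snd c \<circ> \<gamma> has_derivative f' s) (at s within ?J)"
    by (rule smooth_on_imp_C1) blast
  then have "(snd c \<circ> \<gamma> has_derivative f' t) (at t within {a..b})"
    unfolding at_within_open_preimage[OF cont t chartD(1)[OF cA(1)] cA(2), symmetric] using cA t by simp
  then have "(snd c \<circ> \<gamma>) differentiable (at t within {a..b})" by (rule differentiableI)
  then show ?thesis
    using c by (simp add: velocity_def vector_derivative_works)
qed

text \<open>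
  The coordinates of the velocity in different charts transform by the derivatives of the transition
  maps, by the chain rule.
\<close>

lemma smooth_curve_velocity_tangent:
  assumes ab: "a < b" and cont: "continuous_on {a..b} \<gamma>" and sm: "smooth_curve_on A {a..b} \<gamma>"
    and t: "t \<in> {a..b}" and c: "c \<in> charts_at A (\<gamma> t)"
  shows "velocity A a b \<gamma> t = tangent_vector A c (\<gamma> t) (velocity A a b \<gamma> t c)"
proof
  fix c'
  show "velocity A a b \<gamma> t c' = tangent_vector A c (\<gamma> t) (velocity A a b \<gamma> t c) c'"
  proof (cases "c' \<in> charts_at A (\<gamma> t)")
    case True
    let ?D = "transition_deriv c c' (\<gamma> t) (velocity A a b \<gamma> t c)"
    have "(transition c c' \<circ> (snd c \<circ> \<gamma>) has_vector_derivative ?D) (at t within {a..b})"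
      by (rule vector_derivative_diff_chain_within[OF smooth_curve_velocity[OF assms]])
         (simp add: has_derivative_at_withinI[OF transition_has_derivative[OF c True]])
    moreover obtain d where "d > 0" "\<And>s. s \<in> {a..b} \<Longrightarrow> dist s t < d \<Longrightarrow> \<gamma> s \<in> fst c"
      using curve_stays_near[OF cont t chartD(1)] charts_atD[OF c] by metis
    moreover have "(transition c c' \<circ> (snd c \<circ> \<gamma>)) s = (snd c' \<circ> \<gamma>) s" if "\<gamma> s \<in> fst c" for s
      using that charts_atD[OF c] by (simp add: transition_chart)
    ultimately have "(snd c' \<circ> \<gamma> has_vector_derivative ?D) (at t within {a..b})"
      using t by (elim has_vector_derivative_transform_within) blast+
    then have "vector_derivative (snd c' \<circ> \<gamma>) (at t within {a..b}) = ?D"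
      by (rule vector_derivative_Icc[OF ab t])
    then show ?thesis
      using True unfolding velocity_def[of A a b \<gamma> t] tangent_vector_def
      by (simp add: velocity_def)
  qed (simp add: velocity_def tangent_vector_def)
qed

lemma velocity_subinterval:
  assumes "a \<le> a'" "a' < t" "t < b'" "b' \<le> b"
  shows "velocity A a b \<gamma> t = velocity A a' b' \<gamma> t"
proof -
  have "at t within {a..b} = at t" "at t within {a'..b'} = at t"
    using assms by (auto intro!: at_within_Icc_at)
  then show ?thesis unfolding velocity_def by metis
qed

end

section \<open>The speed of a piecewise smooth curve\<close>

lemma trivial_subdivision: "subdivision 0 1 1 (\<lambda>i. if i = 0 then 0 else 1)"
  by (auto simp: subdivision_def mono_on_def)

lemma subdivision_piece:
  assumes sub: "subdivision a b n \<tau>" and t: "t \<in> {a..b}" "t \<notin> \<tau> ` {..n}"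
  obtains i where "i < n" "\<tau> i < t" "t < \<tau> (Suc i)"
proof -
  define j where "j = (LEAST j. t < \<tau> j)"
  have "t \<noteq> \<tau> n" using t(2) by blast
  then have "t < \<tau> n" using sub t by (auto simp: subdivision_def)
  then have j: "t < \<tau> j" "j \<le> n" unfolding j_def by (auto intro: LeastI Least_le)
  have "j \<noteq> 0" using j(1) sub t(1) by (metis atLeastAtMost_iff leD subdivision_def)
  then obtain i where i: "j = Suc i" by (cases j) auto
  have "\<not> t < \<tau> i" using not_less_Least[of i "\<lambda>j. t < \<tau> j"] i by (simp add: j_def)
  moreover have "t \<noteq> \<tau> i" using t(2) i j(2) by auto
  ultimately show thesis using that[of i] i j by auto
qed

text \<open>
  The norm of \<open>T\<^sub>pM\<close>, carried over to the model space by the chart \<open>c\<close>.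
\<close>

definition coord_norm ::
  "('a, 'e::real_normed_vector) chart set \<Rightarrow> ('a \<Rightarrow> ('a, 'e) tangent \<Rightarrow> real)
    \<Rightarrow> ('a, 'e) chart \<Rightarrow> 'a \<Rightarrow> 'e \<Rightarrow> real" where
  "coord_norm A N c p \<xi> = N p (tangent_vector A c p \<xi>)"

context finsler_manifold
begin

lemma coord_norm_norm_function:
  assumes c: "c \<in> charts_at A p"
  shows "norm_function (coord_norm A N c p)"
proof -
  note T = tangent_vector_in_tangent_space[OF c]
  have "N p (tangent_vector A c p \<xi>) = 0 \<longleftrightarrow> \<xi> = 0" for \<xi>
  proof -
    have "N p (tangent_vector A c p \<xi>) = 0 \<longleftrightarrow> tangent_vector A c p \<xi> = (\<lambda>c. 0)"
      using norm[of p] T unfolding norm_on_def by blast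
    also have "\<dots> \<longleftrightarrow> \<xi> = 0"
      using tangent_vector_coord[OF c, of \<xi>] tangent_vector_scale[OF c, of 0 \<xi>] by auto
    finally show ?thesis .
  qed
  then show ?thesis
    using norm[of p] T unfolding norm_function_def coord_norm_def norm_on_def
    by (simp add: tangent_vector_add[OF c] tangent_vector_scale[OF c])
qed

lemma coord_norm_continuous:
  "c \<in> A \<Longrightarrow> continuous_on (fst c \<times> UNIV) (\<lambda>z. coord_norm A N c (fst z) (snd z))"
  using continuous by (simp add: coord_norm_def case_prod_unfold)

lemma coord_norm_continuous_at:
  assumes "c \<in> charts_at A p"
  shows "continuous_on UNIV (coord_norm A N c p)"
  by (rule continuous_on_compose2[OF coord_norm_continuous, where f = "\<lambda>\<xi>. (p, \<xi>)", simplified])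
     (use charts_atD[OF assms] in \<open>auto intro!: continuous_intros\<close>)

lemma smooth_curve_speed_continuous:
  assumes ab: "a < b" and cont: "continuous_on {a..b} \<gamma>" and sm: "smooth_curve_on A {a..b} \<gamma>"
  shows "continuous_on {a..b} (\<lambda>t. N (\<gamma> t) (velocity A a b \<gamma> t))"
  unfolding continuous_on_eq_continuous_within
proof
  fix t assume t: "t \<in> {a..b}"
  obtain c where c: "c \<in> charts_at A (\<gamma> t)" using charts_at_nonempty by blast
  let ?J = "{s \<in> {a..b}. \<gamma> s \<in> fst c}"
  have cA: "c \<in> A" "\<gamma> t \<in> fst c" using charts_atD[OF c] by auto
  have cs: "c \<in> charts_at A (\<gamma> s)" if "s \<in> ?J" for s using that cA by (simp add: charts_at_def)
  note within = at_within_open_preimage[OF cont _ chartD(1)[OF cA(1)]]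
  have "smooth_on ?J (snd c \<circ> \<gamma>)" using sm cA by (auto simp: smooth_curve_on_def)
  then obtain f' where f': "\<And>s. s \<in> ?J \<Longrightarrow> (snd c \<circ> \<gamma> has_derivative f' s) (at s within ?J)"
    "\<And>v. continuous_on ?J (\<lambda>s. f' s v)"
    by (rule smooth_on_imp_C1) blast
  have vel: "velocity A a b \<gamma> s c = f' s 1" if s: "s \<in> ?J" for s
  proof -
    have "(snd c \<circ> \<gamma> has_derivative f' s) (at s within {a..b})"
      using f'(1)[OF s] within[of s] s by auto
    moreover have "f' s = (\<lambda>r. r *\<^sub>R f' s 1)"
    proof
      fix r show "f' s r = r *\<^sub>R f' s 1"
        using linear_scale[OF has_derivative_linear[OF f'(1)[OF s]], of r 1] by simp
    qed
    ultimately have "(snd c \<circ> \<gamma> has_vector_derivative f' s 1) (at s within {a..b})"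
      unfolding has_vector_derivative_def by metis
    then have "vector_derivative (snd c \<circ> \<gamma>) (at s within {a..b}) = f' s 1"
      by (rule vector_derivative_Icc[OF ab, rotated]) (use s in simp)
    then show ?thesis using cs[OF s] by (simp add: velocity_def)
  qed
  have "continuous_on ?J (\<lambda>s. coord_norm A N c (\<gamma> s) (f' s 1))"
    by (rule continuous_on_compose2[OF coord_norm_continuous[OF cA(1)], where f = "\<lambda>s. (\<gamma> s, f' s 1)", simplified])
       (insert f'(2)[of 1], auto intro!: continuous_intros continuous_on_subset[OF cont])
  moreover have "coord_norm A N c (\<gamma> s) (f' s 1) = N (\<gamma> s) (velocity A a b \<gamma> s)" if s: "s \<in> ?J" for s
    using smooth_curve_velocity_tangent[OF ab cont sm _ cs[OF s]] s vel[OF s]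
    by (simp add: coord_norm_def)
  ultimately have "continuous_on ?J (\<lambda>s. N (\<gamma> s) (velocity A a b \<gamma> s))"
    using continuous_on_cong by (metis (no_types, lifting))
  then show "continuous (at t within {a..b}) (\<lambda>s. N (\<gamma> s) (velocity A a b \<gamma> s))"
    using within[OF t cA(2)] t cA(2) by (metis (mono_tags, lifting) continuous_on_eq_continuous_within mem_Collect_eq)
qed

text \<open>
  At break points the velocity need not be a tangent vector, so \<open>N\<close> says nothing about it there. The
  function \<open>g\<close> is the speed with these finitely many values replaced by \<open>0\<close>. Integrability holds because
  the speed is continuous on each smooth piece up to its end points. All later arguments about lengths
  use only this lemma, not the definition of the velocity.
\<close>

lemma piecewise_smooth_speed:
  assumes \<gamma>: "piecewise_smooth_curve A a b \<gamma>"
  obtains g S where "finite S" "(g has_integral (integral {a..b} (\<lambda>t. N (\<gamma> t) (velocity A a b \<gamma> t)))) {a..b}"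
    "\<And>t. t \<in> {a..b} \<Longrightarrow> g t \<ge> 0"
    "\<And>t c. t \<in> {a..b} - S \<Longrightarrow> c \<in> charts_at A (\<gamma> t) \<Longrightarrow>
      \<exists>\<xi>. (snd c \<circ> \<gamma> has_vector_derivative \<xi>) (at t) \<and> g t = coord_norm A N c (\<gamma> t) \<xi>"
proof -
  obtain n \<tau> where sub: "subdivision a b n \<tau>" and sm: "\<And>i. i < n \<Longrightarrow> smooth_curve_on A {\<tau> i..\<tau> (Suc i)} \<gamma>"
    and cont: "continuous_on {a..b} \<gamma>" and ab: "a \<le> b"
    using \<gamma> unfolding piecewise_smooth_curve_def by blast
  have \<tau>: "a \<le> \<tau> i" "\<tau> i \<le> b" "i < n \<Longrightarrow> \<tau> i \<le> \<tau> (Suc i)" if "i \<le> n" for i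
    using sub that unfolding subdivision_def mono_on_def
    by (metis atMost_iff le0, metis atMost_iff order_refl, metis Suc_leI atMost_iff le_SucI order_refl)
  have cont': "continuous_on {\<tau> i..\<tau> (Suc i)} \<gamma>" if "i < n" for i
    using that \<tau>[of i] \<tau>[of "Suc i"] by (intro continuous_on_subset[OF cont]) auto
  let ?v = "\<lambda>t. N (\<gamma> t) (velocity A a b \<gamma> t)"
  have vel: "velocity A a b \<gamma> t = velocity A (\<tau> i) (\<tau> (Suc i)) \<gamma> t"
    if "i < n" "\<tau> i < t" "t < \<tau> (Suc i)" for i t
    using that \<tau>[of i] \<tau>[of "Suc i"] by (intro velocity_subinterval) auto
  have piece: "?v integrable_on {\<tau> i..\<tau> (Suc i)}" if i: "i < n" for i
  proof (cases "\<tau> i < \<tau> (Suc i)")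
    case True
    have "(\<lambda>t. N (\<gamma> t) (velocity A (\<tau> i) (\<tau> (Suc i)) \<gamma> t)) integrable_on {\<tau> i..\<tau> (Suc i)}"
      by (intro integrable_continuous_real smooth_curve_speed_continuous True cont' sm i)
    then show ?thesis
      by (rule integrable_spike_finite[of "{\<tau> i, \<tau> (Suc i)}", rotated 2]) (auto simp: vel[OF i])
  next
    case False
    then have "\<tau> i = \<tau> (Suc i)" using \<tau>(3)[of i] i by simp
    then show ?thesis using integrable_on_refl[where f = ?v and a = "\<tau> i"] by simp
  qed
  have "?v integrable_on {a..\<tau> i}" if "i \<le> n" for i
    using that
  proof (induction i)
    case 0
    then show ?case using sub integrable_on_refl[where f = ?v and a = a] by (simp add: subdivision_def)
  next
    case (Suc i)
    then show ?case
      using Henstock_Kurzweil_Integration.integrable_combine[where a = a and c = "\<tau> i" and b = "\<tau> (Suc i)" and f = ?v] piece[of i] \<tau>[of i] by simp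
  qed
  from this[of n] have int: "?v integrable_on {a..b}" using sub by (simp add: subdivision_def)
  define S where "S = \<tau> ` {..n}"
  have reg: "(snd c \<circ> \<gamma> has_vector_derivative velocity A a b \<gamma> t c) (at t) \<and>
     ?v t = coord_norm A N c (\<gamma> t) (velocity A a b \<gamma> t c)"
    if t: "t \<in> {a..b} - S" and c: "c \<in> charts_at A (\<gamma> t)" for t c
  proof -
    obtain i where i: "i < n" "\<tau> i < t" "t < \<tau> (Suc i)"
      using subdivision_piece[OF sub, of t] t unfolding S_def by blast
    have t': "t \<in> {\<tau> i..\<tau> (Suc i)}" and lt: "\<tau> i < \<tau> (Suc i)" using i by auto
    have "at t within {\<tau> i..\<tau> (Suc i)} = at t" using i by (simp add: at_within_Icc_at)
    then show ?thesis
      using smooth_curve_velocity[OF lt cont'[OF i(1)] sm[OF i(1)] t' c]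
        smooth_curve_velocity_tangent[OF lt cont'[OF i(1)] sm[OF i(1)] t' c] vel[OF i]
      by (simp add: coord_norm_def)
  qed
  define g where "g t = (if t \<in> S then 0 else ?v t)" for t
  have fin: "finite S" by (simp add: S_def)
  show thesis
  proof (rule that)
    show "finite S" by (rule fin)
    show "(g has_integral (integral {a..b} ?v)) {a..b}"
      using integrable_integral[OF int] by (rule has_integral_spike_finite[OF fin, rotated]) (simp add: g_def)
    show "g t \<ge> 0" if t: "t \<in> {a..b}" for t
    proof (cases "t \<in> S")
      case False
      obtain c where c: "c \<in> charts_at A (\<gamma> t)" using charts_at_nonempty by blast
      show ?thesis
        using reg[of t c] t False c norm_function_nonneg[OF coord_norm_norm_function[OF c]]
        by (simp add: g_def)
    qed (simp add: g_def)
    show "\<exists>\<xi>. (snd c \<circ> \<gamma> has_vector_derivative \<xi>) (at t) \<and> g t = coord_norm A N c (\<gamma> t) \<xi>"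
      if t: "t \<in> {a..b} - S" and c: "c \<in> charts_at A (\<gamma> t)" for t c
      using reg[OF t c] t by (auto simp: g_def)
  qed
qed

end

section \<open>The Finsler distance near a point\<close>

context finsler_manifold
begin

lemma integral_speed_nonneg:
  assumes "piecewise_smooth_curve A a b \<gamma>"
  shows "0 \<le> integral {a..b} (\<lambda>t. N (\<gamma> t) (velocity A a b \<gamma> t))"
  using piecewise_smooth_speed[OF assms] has_integral_nonneg by metis

lemma finsler_dist_le:
  assumes "piecewise_smooth_curve A a b \<gamma>" "\<gamma> a = p" "\<gamma> b = q"
  shows "finsler_dist A N p q \<le> integral {a..b} (\<lambda>t. N (\<gamma> t) (velocity A a b \<gamma> t))"
  unfolding finsler_dist_def
proof (rule cInf_lower)
  show "bdd_below {integral {a..b} (\<lambda>t. N (\<gamma> t) (velocity A a b \<gamma> t)) |a b \<gamma>.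
      piecewise_smooth_curve A a b \<gamma> \<and> \<gamma> a = p \<and> \<gamma> b = q}"
    using integral_speed_nonneg by (intro bdd_belowI[of _ 0]) blast
qed (use assms in blast)

text \<open>
  In another chart \<open>c'\<close> the segment is the composition of an affine map with a transition map.
\<close>

lemma coordinate_segment:
  assumes c: "c \<in> A"
    and seg: "\<And>t. t \<in> {0..1} \<Longrightarrow> x + t *\<^sub>R v \<in> snd c ` fst c"
  shows "piecewise_smooth_curve A 0 1 (\<lambda>t. inv_into (fst c) (snd c) (x + t *\<^sub>R v))"
proof -
  let ?\<gamma> = "\<lambda>t. inv_into (fst c) (snd c) (x + t *\<^sub>R v)"
  have "continuous_on {0..1} ?\<gamma>"
    by (rule continuous_on_compose2[OF homeomorphism_cont2[OF chartD(3)[OF c]]])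
       (use seg in \<open>auto intro!: continuous_intros\<close>)
  moreover note trivial_subdivision
  moreover have "smooth_curve_on A {0..1} ?\<gamma>"
    unfolding smooth_curve_on_def
  proof
    fix c' assume c': "c' \<in> A"
    show "smooth_on {t \<in> {0..1}. ?\<gamma> t \<in> fst c'} (snd c' \<circ> ?\<gamma>)"
    proof (rule smooth_on_cong[OF smooth_on_compose_line[OF compatible[OF c c']]])
      fix t assume t: "t \<in> {t \<in> {0..1}. ?\<gamma> t \<in> fst c'}"
      then have x: "x + t *\<^sub>R v \<in> snd c ` fst c" using seg by blast
      then show "x + t *\<^sub>R v \<in> snd c ` (fst c \<inter> fst c')"
        using t chart_inverse(2,3)[OF c x] by (intro image_eqI[of _ _ "?\<gamma> t"]) auto
      show "transition c c' (x + t *\<^sub>R v) = (snd c' \<circ> ?\<gamma>) t"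
        by (simp add: transition_def)
    qed
  qed
  ultimately show ?thesis
    unfolding piecewise_smooth_curve_def
    by (intro conjI exI[of _ "1::nat"] exI[of _ "\<lambda>i::nat. if i = 0 then 0 else 1::real"]) auto
qed

text \<open>
  The image of the coordinate segment is a competitor for the distance; its speed is the norm of the
  constant vector \<open>y - x\<close> at its points.
\<close>

lemma finsler_dist_le_coordinates:
  assumes c: "c \<in> A"
    and seg: "\<And>t. t \<in> {0..1} \<Longrightarrow> x + t *\<^sub>R (y - x) \<in> snd c ` fst c"
    and le: "\<And>t. t \<in> {0..1} \<Longrightarrow>
      coord_norm A N c (inv_into (fst c) (snd c) (x + t *\<^sub>R (y - x))) (y - x) \<le> K"
  shows "finsler_dist A N (inv_into (fst c) (snd c) x) (inv_into (fst c) (snd c) y) \<le> K"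
proof -
  let ?\<gamma> = "\<lambda>t. inv_into (fst c) (snd c) (x + t *\<^sub>R (y - x))"
  have pw: "piecewise_smooth_curve A 0 1 ?\<gamma>" by (rule coordinate_segment[OF c seg])
  obtain g S where S: "finite S"
    and g: "(g has_integral (integral {0..1} (\<lambda>t. N (?\<gamma> t) (velocity A 0 1 ?\<gamma> t)))) {0..1}"
    and speed: "\<And>t c. t \<in> {0..1} - S \<Longrightarrow> c \<in> charts_at A (?\<gamma> t) \<Longrightarrow>
      \<exists>\<xi>. (snd c \<circ> ?\<gamma> has_vector_derivative \<xi>) (at t) \<and> g t = coord_norm A N c (?\<gamma> t) \<xi>"
    by (rule piecewise_smooth_speed[OF pw]) blast
  have gK: "g t \<le> K" if t: "t \<in> {0..1} - (S \<union> {0, 1})" for t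
  proof -
    have t01: "t \<in> {0..1}" "0 < t" "t < 1" using t by auto
    have "c \<in> charts_at A (?\<gamma> t)" using c chart_inverse(3)[OF c seg[OF t01(1)]] by (simp add: charts_at_def)
    then obtain \<xi> where \<xi>: "(snd c \<circ> ?\<gamma> has_vector_derivative \<xi>) (at t)" "g t = coord_norm A N c (?\<gamma> t) \<xi>"
      using speed t by blast
    have "((\<lambda>t. x + t *\<^sub>R (y - x)) has_vector_derivative (y - x)) (at t)"
      by (auto intro!: derivative_eq_intros)
    then have "(snd c \<circ> ?\<gamma> has_vector_derivative (y - x)) (at t)"
      by (rule has_vector_derivative_transform_within_open[of _ _ _ "{0<..<1}"])
         (use t01 seg chart_inverse(2)[OF c] in auto)
    then have "\<xi> = y - x" using \<xi>(1) vector_derivative_unique_at by metis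
    then show ?thesis using \<xi>(2) le t01 by simp
  qed
  define h where "h t = (if t \<in> S \<union> {0,1} then K else g t)" for t
  have h: "(h has_integral (integral {0..1} (\<lambda>t. N (?\<gamma> t) (velocity A 0 1 ?\<gamma> t)))) {0..1}"
    using g by (rule has_integral_spike_finite[of "S \<union> {0,1}", rotated 2]) (use S in \<open>auto simp: h_def\<close>)
  have "integral {0..1} (\<lambda>t. N (?\<gamma> t) (velocity A 0 1 ?\<gamma> t)) \<le> K"
    by (rule has_integral_le[OF h]) (use has_integral_const_real[of K 0 1] gK in \<open>auto simp: h_def\<close>)
  then show ?thesis
    using finsler_dist_le[OF pw, of "inv_into (fst c) (snd c) x" "inv_into (fst c) (snd c) y"] by simp
qed

text \<open>
  A curve that starts in a coordinate ball either stays there or has a first exit time \<open>T\<close>. At time \<open>T\<close>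
  it is still in the chart domain: the closed coordinate ball is compact, hence closed in the manifold.
\<close>

lemma coordinate_ball_exit:
  fixes \<gamma> :: "real \<Rightarrow> 'a"
  assumes c: "c \<in> A" and K: "cball x0 R \<subseteq> snd c ` fst c"
    and cont: "continuous_on {a..b} \<gamma>" and ab: "a \<le> b"
    and start: "\<gamma> a \<in> fst c" "snd c (\<gamma> a) \<in> ball x0 R"
  obtains T where "T \<in> {a..b}" "\<And>t. t \<in> {a..T} \<Longrightarrow> \<gamma> t \<in> fst c \<and> snd c (\<gamma> t) \<in> cball x0 R"
    "T = b \<or> dist x0 (snd c (\<gamma> T)) = R"
proof -
  let ?\<psi> = "inv_into (fst c) (snd c)"
  define V where "V = ?\<psi> ` ball x0 R"
  define C where "C = ?\<psi> ` cball x0 R"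
  have image: "q \<in> ?\<psi> ` B \<longleftrightarrow> q \<in> fst c \<and> snd c q \<in> B" if B: "B \<subseteq> snd c ` fst c" for q B
  proof
    assume "q \<in> ?\<psi> ` B"
    then obtain x where "x \<in> B" "q = ?\<psi> x" by blast
    moreover from this have "x \<in> snd c ` fst c" using B by blast
    ultimately show "q \<in> fst c \<and> snd c q \<in> B" using chart_inverse(2,3)[OF c] by metis
  next
    assume "q \<in> fst c \<and> snd c q \<in> B"
    then show "q \<in> ?\<psi> ` B" using chart_inverse(1)[OF c, of q] by (metis image_eqI)
  qed
  have ball: "ball x0 R \<subseteq> snd c ` fst c" using K ball_subset_cball[of x0 R] by blast
  note V = image[OF ball, folded V_def] and C = image[OF K, folded C_def]
  have "open V"
  proof -
    have "openin (top_of_set (snd c ` fst c)) (ball x0 R)" using ball by (simp add: openin_open_eq chartD(2)[OF c])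
    then have "openin (top_of_set (fst c)) V"
      unfolding V_def
      by (rule homeomorphism_imp_open_map[OF homeomorphism_symD[OF chartD(3)[OF c]]])
    then show ?thesis using chartD(1)[OF c] openin_open_trans by blast
  qed
  have "compact C"
    unfolding C_def
    by (rule compact_continuous_image[OF continuous_on_subset[OF homeomorphism_cont2[OF chartD(3)[OF c]] K]])
       (rule compact_cball)
  then have "closed C" by (rule compact_imp_closed)
  define Z where "Z = {t \<in> {a..b}. \<gamma> t \<in> - V}"
  show thesis
  proof (cases "Z = {}")
    case True
    then have "\<gamma> t \<in> V" if "t \<in> {a..b}" for t using that by (auto simp: Z_def)
    then have in_C: "\<gamma> t \<in> fst c \<and> snd c (\<gamma> t) \<in> cball x0 R" if "t \<in> {a..b}" for t
      using that V[of "\<gamma> t"] ball_subset_cball[of x0 R] by blast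
    show thesis by (rule that[of b]) (use ab in_C in simp_all)
  next
    case False
    have Z_eq: "Z = {a..b} \<inter> \<gamma> -` (- V)" by (auto simp: Z_def)
    have "closed Z"
      unfolding Z_eq using \<open>open V\<close> by (intro continuous_closed_preimage cont) auto
    then have "compact ({a..b} \<inter> Z)" by (rule compact_Int_closed[OF compact_Icc])
    moreover have "{a..b} \<inter> Z = Z" by (auto simp: Z_def)
    ultimately have "compact Z" by simp
    then obtain T where T: "T \<in> Z" "\<And>t. t \<in> Z \<Longrightarrow> T \<le> t"
      using compact_attains_inf[OF _ False] by metis
    have "T \<in> {a..b}" "\<gamma> T \<notin> V" using T(1) by (auto simp: Z_def)
    moreover have "\<gamma> a \<in> V" using V start by blast
    ultimately have "a < T" by (cases "T = a") auto
    have before: "\<gamma> t \<in> V" if "t \<in> {a..<T}" for t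
    proof (rule ccontr)
      assume "\<gamma> t \<notin> V"
      then have "t \<in> Z" using that \<open>T \<in> {a..b}\<close> by (simp add: Z_def)
      then show False using T(2)[of t] that by simp
    qed
    have "closed ({a..b} \<inter> \<gamma> -` C)"
      using \<open>closed C\<close> by (intro continuous_closed_preimage cont) auto
    moreover have "{a..<T} \<subseteq> {a..b} \<inter> \<gamma> -` C"
    proof
      fix t assume t: "t \<in> {a..<T}"
      have "\<gamma> t \<in> C" using before[OF t] V[of "\<gamma> t"] C[of "\<gamma> t"] by simp
      then show "t \<in> {a..b} \<inter> \<gamma> -` C" using t \<open>T \<in> {a..b}\<close> by simp
    qed
    ultimately have "closure {a..<T} \<subseteq> {a..b} \<inter> \<gamma> -` C" by (intro closure_minimal)
    then have in_C: "\<gamma> t \<in> C" if "t \<in> {a..T}" for t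
      using that \<open>a < T\<close> by auto
    show thesis
    proof (rule that[OF \<open>T \<in> {a..b}\<close>])
      show "\<gamma> t \<in> fst c \<and> snd c (\<gamma> t) \<in> cball x0 R" if "t \<in> {a..T}" for t
        using in_C[OF that] C by blast
      have "\<gamma> T \<in> C" using in_C[of T] \<open>a < T\<close> by simp
      then show "T = b \<or> dist x0 (snd c (\<gamma> T)) = R"
        using C[of "\<gamma> T"] V[of "\<gamma> T"] \<open>\<gamma> T \<notin> V\<close> by auto
    qed
  qed
qed

text \<open>
  A competing curve may leave the chart, but then its part up to the first exit from the ball of
  radius \<open>R\<close> is long enough already; this is the hypothesis \<open>exit\<close>. Inside the ball the length is
  bounded below by \<open>\<mu>\<close> times the increment of the coordinates, measured with \<open>n\<close>.
\<close>

lemma finsler_dist_ge_coordinates: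
  assumes c: "c \<in> A" and R: "cball x0 R \<subseteq> snd c ` fst c"
    and n: "norm_function n" "continuous_on UNIV n" and \<mu>: "0 \<le> \<mu>"
    and ge: "\<And>z \<xi>. z \<in> cball x0 R \<Longrightarrow> \<mu> * n \<xi> \<le> coord_norm A N c (inv_into (fst c) (snd c) z) \<xi>"
    and x: "x \<in> ball x0 R" and y: "y \<in> ball x0 R"
    and exit: "\<And>z. dist x0 z = R \<Longrightarrow> n (y - x) \<le> n (z - x)"
  shows "\<mu> * n (y - x) \<le> finsler_dist A N (inv_into (fst c) (snd c) x) (inv_into (fst c) (snd c) y)"
  unfolding finsler_dist_def
proof (rule cInf_greatest)
  let ?\<psi> = "inv_into (fst c) (snd c)"
  have sub: "ball x0 R \<subseteq> snd c ` fst c" using R ball_subset_cball[of x0 R] by blast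
  have "x + t *\<^sub>R (y - x) \<in> snd c ` fst c" if "t \<in> {0..1}" for t
  proof -
    have "(1 - t) *\<^sub>R x + t *\<^sub>R y \<in> ball x0 R"
      using convexD[OF convex_ball x y, of "1 - t" t] that by simp
    then show ?thesis using sub by (auto simp: algebra_simps)
  qed
  then have "piecewise_smooth_curve A 0 1 (\<lambda>t. ?\<psi> (x + t *\<^sub>R (y - x)))"
    by (rule coordinate_segment[OF c])
  then show "{integral {a..b} (\<lambda>t. N (\<gamma> t) (velocity A a b \<gamma> t)) |a b \<gamma>.
      piecewise_smooth_curve A a b \<gamma> \<and> \<gamma> a = ?\<psi> x \<and> \<gamma> b = ?\<psi> y} \<noteq> {}"
    by (fastforce simp: algebra_simps)
next
  let ?\<psi> = "inv_into (fst c) (snd c)"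
  have sub: "ball x0 R \<subseteq> snd c ` fst c" using R ball_subset_cball[of x0 R] by blast
  fix l assume "l \<in> {integral {a..b} (\<lambda>t. N (\<gamma> t) (velocity A a b \<gamma> t)) |a b \<gamma>.
      piecewise_smooth_curve A a b \<gamma> \<and> \<gamma> a = ?\<psi> x \<and> \<gamma> b = ?\<psi> y}"
  then obtain a b \<gamma> where l: "l = integral {a..b} (\<lambda>t. N (\<gamma> t) (velocity A a b \<gamma> t))"
    and pw: "piecewise_smooth_curve A a b \<gamma>" and ends: "\<gamma> a = ?\<psi> x" "\<gamma> b = ?\<psi> y" by blast
  have cont: "continuous_on {a..b} \<gamma>" and ab: "a \<le> b"
    using pw by (auto simp: piecewise_smooth_curve_def)
  obtain g S where S: "finite S"
    and g: "(g has_integral l) {a..b}" "\<And>t. t \<in> {a..b} \<Longrightarrow> g t \<ge> 0"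
    and speed: "\<And>t c. t \<in> {a..b} - S \<Longrightarrow> c \<in> charts_at A (\<gamma> t) \<Longrightarrow>
      \<exists>\<xi>. (snd c \<circ> \<gamma> has_vector_derivative \<xi>) (at t) \<and> g t = coord_norm A N c (\<gamma> t) \<xi>"
    unfolding l by (rule piecewise_smooth_speed[OF pw]) blast
  define u where "u = snd c \<circ> \<gamma>"
  have u: "u a = x" "u b = y"
    using ends x y sub chart_inverse(2)[OF c] by (auto simp: u_def)
  have "\<gamma> a \<in> fst c" unfolding ends(1) by (rule chart_inverse(3)[OF c]) (use x sub in blast)
  moreover have "snd c (\<gamma> a) \<in> ball x0 R" using u(1) x by (simp add: u_def)
  ultimately obtain T where T: "T \<in> {a..b}"
    and inside: "\<And>t. t \<in> {a..T} \<Longrightarrow> \<gamma> t \<in> fst c \<and> snd c (\<gamma> t) \<in> cball x0 R"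
    and T_end: "T = b \<or> dist x0 (snd c (\<gamma> T)) = R"
    using coordinate_ball_exit[OF c R cont ab] by metis
  have u_cont: "continuous_on {a..T} u"
    unfolding u_def
    by (rule continuous_on_compose[OF continuous_on_subset[OF cont]
          continuous_on_subset[OF homeomorphism_cont1[OF chartD(3)[OF c]]]])
       (use T inside in auto)
  have deriv: "(u has_vector_derivative vector_derivative u (at t)) (at t)"
    and slow: "\<mu> * n (vector_derivative u (at t)) \<le> g t" if t: "t \<in> {a..T} - S" for t
  proof -
    have c': "c \<in> charts_at A (\<gamma> t)" using inside t c by (simp add: charts_at_def)
    obtain \<xi> where \<xi>: "(u has_vector_derivative \<xi>) (at t)" "g t = coord_norm A N c (\<gamma> t) \<xi>"
      using speed[OF _ c'] t T unfolding u_def by fastforce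
    then have v: "vector_derivative u (at t) = \<xi>" by (intro vector_derivative_at)
    then show "(u has_vector_derivative vector_derivative u (at t)) (at t)" using \<xi> by simp
    have "\<gamma> t = ?\<psi> (snd c (\<gamma> t))" using inside t chart_inverse(1)[OF c] by simp
    then show "\<mu> * n (vector_derivative u (at t)) \<le> g t"
      using ge[of "snd c (\<gamma> t)" \<xi>] inside t v \<xi>(2) by simp
  qed
  have gT: "g integrable_on {a..T}"
    by (rule integrable_subinterval_real[OF has_integral_integrable[OF g(1)]]) (use T in simp)
  have "n (\<mu> *\<^sub>R u T - \<mu> *\<^sub>R u a) \<le> integral {a..T} g"
  proof (rule norm_function_increment_le_integral[OF n S])
    fix t assume t: "t \<in> {a<..<T} - S"
    then have t': "t \<in> {a..T} - S" by auto
    from has_derivative_scaleR_right[OF deriv[OF t', unfolded has_vector_derivative_def], of \<mu>]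
    show "((\<lambda>t. \<mu> *\<^sub>R u t) has_vector_derivative \<mu> *\<^sub>R vector_derivative u (at t)) (at t)"
      unfolding has_vector_derivative_def scaleR_left_commute[of \<mu>] .
    show "n (\<mu> *\<^sub>R vector_derivative u (at t)) \<le> g t"
      using slow[OF t'] \<mu> norm_function_scale[OF n(1), of \<mu>] by (metis abs_of_nonneg)
  qed (use T g(2) gT u_cont in \<open>auto intro!: continuous_intros\<close>)
  also have "\<dots> \<le> integral {a..b} g"
    by (rule integral_subset_le[OF _ gT has_integral_integrable[OF g(1)]]) (use T g(2) in simp_all)
  also have "\<dots> = l" using g(1) by (rule integral_unique)
  finally have "\<mu> * n (u T - x) \<le> l" 
    using \<mu> u norm_function_scale[OF n(1), of \<mu> "u T - x"] by (simp add: scaleR_diff_right)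
  moreover have "n (y - x) \<le> n (u T - x)"
    using T_end exit[of "u T"] u by (auto simp: u_def)
  ultimately show "\<mu> * n (y - x) \<le> l" using mult_left_mono[OF _ \<mu>] by fastforce
qed

text \<open>
  Continuity of the Finsler structure makes the norms at nearby points uniformly close on the compact
  unit sphere, and homogeneity extends this to all vectors as a relative error.
\<close>

lemma coord_norm_close:
  assumes c: "c \<in> charts_at A p" and \<epsilon>: "\<epsilon> > 0"
  obtains R where "R > 0" "cball (snd c p) R \<subseteq> snd c ` fst c"
    "\<And>x \<xi>. x \<in> cball (snd c p) R \<Longrightarrow>
      \<bar>coord_norm A N c (inv_into (fst c) (snd c) x) \<xi> - coord_norm A N c p \<xi>\<bar> \<le> \<epsilon> * coord_norm A N c p \<xi>"
proof -
  let ?\<psi> = "inv_into (fst c) (snd c)" and ?x0 = "snd c p" and ?n = "coord_norm A N c p"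
  have cA: "c \<in> A" "p \<in> fst c" using charts_atD[OF c] by auto
  obtain R0 where R0: "R0 > 0" "cball ?x0 R0 \<subseteq> snd c ` fst c"
    using chartD(2)[OF cA(1)] cA(2) open_contains_cball by blast
  note n = coord_norm_norm_function[OF c]
  obtain \<kappa> where \<kappa>: "\<kappa> > 0" "\<And>v. \<kappa> * norm v \<le> ?n v"
    using norm_function_ge_norm[OF n coord_norm_continuous_at[OF c]] by blast
  let ?K = "cball ?x0 R0 \<times> sphere (0::'e) 1" and ?f = "\<lambda>z. coord_norm A N c (?\<psi> (fst z)) (snd z)"
  have "sphere (0::'e) 1 = cball 0 1 - ball 0 1" by auto
  then have "compact (sphere (0::'e) 1)" using compact_diff[OF compact_cball open_ball] by metis
  then have "compact ?K" by (intro compact_Times compact_cball)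
  moreover have "continuous_on ?K ?f"
  proof (rule continuous_on_compose2[OF coord_norm_continuous[OF cA(1)], where f = "\<lambda>z. (?\<psi> (fst z), snd z)", simplified])
    have "continuous_on ?K (\<lambda>z. ?\<psi> (fst z))"
      by (rule continuous_on_compose2[OF homeomorphism_cont2[OF chartD(3)[OF cA(1)]]])
         (use R0 in \<open>auto intro!: continuous_intros\<close>)
    then show "continuous_on ?K (\<lambda>z. (?\<psi> (fst z), snd z))" by (intro continuous_intros)
    show "(\<lambda>z. (?\<psi> (fst z), snd z)) ` ?K \<subseteq> fst c \<times> UNIV"
      using R0 chart_inverse(3)[OF cA(1)] by auto
  qed
  ultimately have "uniformly_continuous_on ?K ?f" by (intro compact_uniformly_continuous)
  moreover have "\<epsilon> * \<kappa> > 0" using \<epsilon> \<kappa> by simp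
  ultimately obtain \<delta> where \<delta>: "\<delta> > 0"
    "\<And>z z'. z \<in> ?K \<Longrightarrow> z' \<in> ?K \<Longrightarrow> dist z' z < \<delta> \<Longrightarrow> dist (?f z') (?f z) < \<epsilon> * \<kappa>"
    unfolding uniformly_continuous_on_def by metis
  show thesis
  proof (rule that[of "min R0 (\<delta> / 2)"])
    show "min R0 (\<delta> / 2) > 0" using R0 \<delta> by simp
    show "cball ?x0 (min R0 (\<delta> / 2)) \<subseteq> snd c ` fst c" using R0 by auto
    fix x \<xi> assume x: "x \<in> cball ?x0 (min R0 (\<delta> / 2))"
    then have x': "x \<in> cball ?x0 R0" "dist x ?x0 < \<delta>" using \<delta>(1) by (auto simp: dist_commute)
    have "?\<psi> x \<in> fst c" using x' R0 chart_inverse(3)[OF cA(1)] by blast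
    then have nx: "norm_function (coord_norm A N c (?\<psi> x))"
      using cA by (intro coord_norm_norm_function) (simp add: charts_at_def)
    show "\<bar>coord_norm A N c (?\<psi> x) \<xi> - ?n \<xi>\<bar> \<le> \<epsilon> * ?n \<xi>"
    proof (cases "\<xi> = 0")
      case True
      then show ?thesis using norm_function_eq_0[OF n, of 0] norm_function_eq_0[OF nx, of 0] by simp
    next
      case False
      define e where "e = \<xi> /\<^sub>R norm \<xi>"
      have e: "norm e = 1" "\<xi> = norm \<xi> *\<^sub>R e" using False by (auto simp: e_def)
      have "\<bar>coord_norm A N c (?\<psi> x) e - ?n e\<bar> < \<epsilon> * \<kappa>"
        using \<delta>(2)[of "(?x0, e)" "(x, e)"] x' R0 e(1) chart_inverse(1)[OF cA]
        by (simp add: dist_Pair_Pair dist_real_def)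
      also have "\<dots> \<le> \<epsilon> * ?n e" using \<kappa>(2)[of e] e(1) \<epsilon> by simp
      finally have "norm \<xi> * \<bar>coord_norm A N c (?\<psi> x) e - ?n e\<bar> \<le> norm \<xi> * (\<epsilon> * ?n e)"
        by (intro mult_left_mono) auto
      moreover have "coord_norm A N c (?\<psi> x) \<xi> = norm \<xi> * coord_norm A N c (?\<psi> x) e"
        "?n \<xi> = norm \<xi> * ?n e"
        using norm_function_scale[OF nx, of "norm \<xi>" e] norm_function_scale[OF n, of "norm \<xi>" e] e(2) by auto
      ultimately show ?thesis by (simp add: right_diff_distrib[symmetric] abs_mult mult_ac)
    qed
  qed
qed

text \<open>
  The Finsler distance is asymptotically the norm of the tangent space. The radius \<open>r\<close> is small compared
  with the radius \<open>R\<close> of the ball on which the norms are close, so that leaving the \<open>R\<close>-ball costs more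
  than going straight from \<open>x\<close> to \<open>y\<close>.
\<close>

lemma finsler_dist_infinitesimal:
  assumes c: "c \<in> charts_at A p" and \<epsilon>: "0 < \<epsilon>" "\<epsilon> < 1"
  obtains r where "r > 0" "ball (snd c p) r \<subseteq> snd c ` fst c"
    "\<And>x y. x \<in> ball (snd c p) r \<Longrightarrow> y \<in> ball (snd c p) r \<Longrightarrow>
      (1 - \<epsilon>) * coord_norm A N c p (y - x)
        \<le> finsler_dist A N (inv_into (fst c) (snd c) x) (inv_into (fst c) (snd c) y)"
    "\<And>x y. x \<in> ball (snd c p) r \<Longrightarrow> y \<in> ball (snd c p) r \<Longrightarrow>
      finsler_dist A N (inv_into (fst c) (snd c) x) (inv_into (fst c) (snd c) y)
        \<le> (1 + \<epsilon>) * coord_norm A N c p (y - x)"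
proof -
  let ?\<psi> = "inv_into (fst c) (snd c)" and ?x0 = "snd c p" and ?n = "coord_norm A N c p"
  have cA: "c \<in> A" "p \<in> fst c" using charts_atD[OF c] by auto
  note n = coord_norm_norm_function[OF c] coord_norm_continuous_at[OF c]
  obtain R where R: "R > 0" "cball ?x0 R \<subseteq> snd c ` fst c"
    and close: "\<And>x \<xi>. x \<in> cball ?x0 R \<Longrightarrow> \<bar>coord_norm A N c (?\<psi> x) \<xi> - ?n \<xi>\<bar> \<le> \<epsilon> * ?n \<xi>"
    using coord_norm_close[OF c \<epsilon>(1)] by blast
  obtain \<kappa> where \<kappa>: "\<kappa> > 0" "\<And>v. \<kappa> * norm v \<le> ?n v"
    using norm_function_ge_norm[OF n] by blast
  have "isCont ?n 0" using n(2) by (simp add: continuous_on_eq_continuous_at)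
  moreover have "\<kappa> * R / 2 > 0" using \<kappa> R by simp
  ultimately obtain d where d: "d > 0" "\<And>v. norm v < d \<Longrightarrow> \<bar>?n v\<bar> < \<kappa> * R / 2"
    using norm_function_eq_0[OF n(1), of 0] unfolding continuous_at_eps_delta
    by (metis dist_norm diff_zero real_norm_def)
  define r where "r = min (R / 2) (d / 2)"
  have r: "r > 0" "r \<le> R / 2" "2 * r \<le> d" using R d by (auto simp: r_def)
  have sub: "ball ?x0 r \<subseteq> cball ?x0 R" "ball ?x0 r \<subseteq> ball ?x0 R" using r R by auto
  show thesis
  proof (rule that[OF r(1)])
    show "ball ?x0 r \<subseteq> snd c ` fst c" using sub R by blast
    fix x y assume x: "x \<in> ball ?x0 r" and y: "y \<in> ball ?x0 r"
    have small: "?n (y - x) \<le> \<kappa> * R / 2"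
    proof -
      have "dist y x < d" using x y r dist_triangle_half_l[of ?x0 x "2 * r" y]
        by (simp add: dist_commute) (smt (verit, best) dist_commute dist_triangle2)
      then show ?thesis using d(2)[of "y - x"] by (simp add: dist_norm)
    qed
    show "(1 - \<epsilon>) * ?n (y - x) \<le> finsler_dist A N (?\<psi> x) (?\<psi> y)"
    proof (rule finsler_dist_ge_coordinates[OF cA(1) R(2) n])
      show "(1 - \<epsilon>) * ?n \<xi> \<le> coord_norm A N c (?\<psi> z) \<xi>" if "z \<in> cball ?x0 R" for z \<xi>
        using close[OF that, of \<xi>] by (simp add: algebra_simps abs_le_iff)
      show "?n (y - x) \<le> ?n (z - x)" if z: "dist ?x0 z = R" for z
      proof -
        have "R \<le> dist ?x0 x + dist z x" using z dist_triangle[of ?x0 z x] by (simp add: dist_commute)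
        then have "R / 2 \<le> norm (z - x)" using x r by (simp add: dist_norm)
        then have "\<kappa> * (R / 2) \<le> \<kappa> * norm (z - x)" using \<kappa>(1) by simp
        then show ?thesis using small \<kappa>(2)[of "z - x"] by simp
      qed
    qed (use \<epsilon> x y sub in auto)
    show "finsler_dist A N (?\<psi> x) (?\<psi> y) \<le> (1 + \<epsilon>) * ?n (y - x)"
    proof (rule finsler_dist_le_coordinates[OF cA(1)])
      fix t :: real assume t: "t \<in> {0..1}"
      have "(1 - t) *\<^sub>R x + t *\<^sub>R y \<in> ball ?x0 r"
        using convexD[OF convex_ball x y, of "1 - t" t] t by simp
      then have z: "x + t *\<^sub>R (y - x) \<in> cball ?x0 R" using sub by (auto simp: algebra_simps)
      then show "x + t *\<^sub>R (y - x) \<in> snd c ` fst c" using R by blast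
      show "coord_norm A N c (?\<psi> (x + t *\<^sub>R (y - x))) (y - x) \<le> (1 + \<epsilon>) * ?n (y - x)"
        using close[OF z, of "y - x"] by (simp add: algebra_simps abs_le_iff)
    qed
  qed
qed

end

section \<open>Path isometries into Euclidean space\<close>

lemma le_curve_length: "ennreal (d (\<gamma> 0) (\<gamma> 1)) \<le> curve_length d 0 1 \<gamma>"
  unfolding curve_length_def
  by (rule SUP_upper2[of "(1, \<lambda>i. if i = 0 then 0 else 1)"]) (use trivial_subdivision in auto)

text \<open>
  A \<open>K\<close>-Lipschitz curve on the unit interval has length at most \<open>K\<close>, and the image of the curve has the
  same length, which bounds the distance of its end points.
\<close>

lemma path_isometry_lipschitz_curve:
  assumes f: "path_isometry UNIV d Y d' f" and K: "0 \<le> K"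
    and lip: "\<And>s t. s \<in> {0..1} \<Longrightarrow> t \<in> {0..1} \<Longrightarrow> d (\<gamma> s) (\<gamma> t) \<le> K * \<bar>s - t\<bar>"
  shows "curve_length d' 0 1 (f \<circ> \<gamma>) = curve_length d 0 1 \<gamma>" "d' (f (\<gamma> 0)) (f (\<gamma> 1)) \<le> K"
proof -
  have "curve_in UNIV d 0 1 \<gamma>"
    unfolding curve_in_def
  proof (intro conjI ballI allI impI)
    fix t \<epsilon> :: real assume t: "t \<in> {0..1}" and \<epsilon>: "\<epsilon> > 0"
    have "d (\<gamma> t) (\<gamma> s) < \<epsilon>" if s: "s \<in> {0..1}" "\<bar>s - t\<bar> < \<epsilon> / (K + 1)" for s
    proof -
      have "d (\<gamma> t) (\<gamma> s) \<le> K * \<bar>s - t\<bar>" using lip[OF t s(1)] by (simp add: abs_minus_commute)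
      also have "\<dots> \<le> (K + 1) * \<bar>s - t\<bar>" by (simp add: mult_right_mono)
      also have "\<dots> < \<epsilon>" using s(2) K by (simp add: field_simps)
      finally show ?thesis .
    qed
    then show "\<exists>\<delta>>0. \<forall>s\<in>{0..1}. \<bar>s - t\<bar> < \<delta> \<longrightarrow> d (\<gamma> t) (\<gamma> s) < \<epsilon>"
      using K \<epsilon> by (intro exI[of _ "\<epsilon> / (K + 1)"]) auto
  qed auto
  then show eq: "curve_length d' 0 1 (f \<circ> \<gamma>) = curve_length d 0 1 \<gamma>"
    using f unfolding path_isometry_def by blast
  have "curve_length d 0 1 \<gamma> \<le> ennreal K"
    unfolding curve_length_def
  proof (rule SUP_least, clarify)
    fix n \<tau> assume sub: "subdivision 0 1 n \<tau>"
    have step: "d (\<gamma> (\<tau> i)) (\<gamma> (\<tau> (Suc i))) \<le> K * (\<tau> (Suc i) - \<tau> i)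
        \<and> 0 \<le> K * (\<tau> (Suc i) - \<tau> i)" if i: "i < n" for i
    proof -
      have "0 \<le> \<tau> i" "\<tau> i \<le> \<tau> (Suc i)" "\<tau> (Suc i) \<le> 1"
        using sub i unfolding subdivision_def mono_on_def
        by (metis atMost_iff le0 less_imp_le, metis Suc_leI atMost_iff le_SucI less_imp_le order_refl,
            metis Suc_leI atMost_iff order_refl)
      then show ?thesis using lip[of "\<tau> i" "\<tau> (Suc i)"] K by auto
    qed
    then have "(\<Sum>i<n. ennreal (d (\<gamma> (\<tau> i)) (\<gamma> (\<tau> (Suc i)))))
        \<le> (\<Sum>i<n. ennreal (K * (\<tau> (Suc i) - \<tau> i)))" by (intro sum_mono ennreal_leI) simp
    also have "\<dots> = ennreal (\<Sum>i<n. K * (\<tau> (Suc i) - \<tau> i))" using step by (intro sum_ennreal) simp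
    also have "(\<Sum>i<n. K * (\<tau> (Suc i) - \<tau> i)) = K"
      using sub by (simp add: sum_distrib_left[symmetric] sum_lessThan_telescope subdivision_def)
    finally show "(\<Sum>i<n. ennreal (d (\<gamma> (\<tau> i)) (\<gamma> (\<tau> (Suc i))))) \<le> ennreal K" .
  qed
  then have "ennreal (d' ((f \<circ> \<gamma>) 0) ((f \<circ> \<gamma>) 1)) \<le> ennreal K"
    using le_curve_length[of d' "f \<circ> \<gamma>"] eq by simp
  then show "d' (f (\<gamma> 0)) (f (\<gamma> 1)) \<le> K" using K by (simp add: ennreal_le_iff)
qed

text \<open>
  The length of the image equals the length of the curve, which is at least the distance of the end
  points; subdivisions come arbitrarily close to it.
\<close>

lemma path_isometry_image_length:
  assumes f: "path_isometry UNIV d Y d' f" and K: "0 \<le> K"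
    and lip: "\<And>s t. s \<in> {0..1} \<Longrightarrow> t \<in> {0..1} \<Longrightarrow> d (\<gamma> s) (\<gamma> t) \<le> K * \<bar>s - t\<bar>"
    and nonneg: "\<And>x y. 0 \<le> d' x y" and c: "c < d (\<gamma> 0) (\<gamma> 1)"
  shows "\<exists>n \<tau>. subdivision 0 1 n \<tau> \<and> c < (\<Sum>i<n. d' (f (\<gamma> (\<tau> i))) (f (\<gamma> (\<tau> (Suc i)))))"
proof (cases "c < 0")
  case True
  then show ?thesis using trivial_subdivision nonneg less_le_trans[OF True sum_nonneg] by meson
next
  case False
  then have "ennreal c < ennreal (d (\<gamma> 0) (\<gamma> 1))" using c by (simp add: ennreal_less_iff)
  also have "\<dots> \<le> curve_length d' 0 1 (f \<circ> \<gamma>)"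
    using path_isometry_lipschitz_curve(1)[OF f K, of \<gamma>] lip le_curve_length[of d \<gamma>] by simp
  finally obtain n \<tau> where "subdivision 0 1 n \<tau>"
    "ennreal c < (\<Sum>i<n. ennreal (d' (f (\<gamma> (\<tau> i))) (f (\<gamma> (\<tau> (Suc i))))))"
    unfolding curve_length_def less_SUP_iff by auto
  then show ?thesis using False nonneg by (auto simp: ennreal_less_iff sum_nonneg)
qed

lemma euclid_dist_nonneg: "0 \<le> euclid_dist k x y"
  and euclid_dist_self: "euclid_dist k x x = 0"
  and euclid_dist_commute: "euclid_dist k x y = euclid_dist k y x"
  and euclid_dist_triangle: "euclid_dist k x z \<le> euclid_dist k x y + euclid_dist k y z"
proof -
  show "euclid_dist k x z \<le> euclid_dist k x y + euclid_dist k y z"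
    using L2_set_triangle_ineq[of "\<lambda>i. x i - y i" "\<lambda>i. y i - z i" "{..<k}"] by (simp add: euclid_dist_def)
qed (simp_all add: euclid_dist_def L2_set_def power2_commute[of "x _"] sum_nonneg)

text \<open>
  The difference of the two sides is the sum of the squares \<open>(a i - b i + c i - d i)\<^sup>2\<close>.
\<close>

lemma euclid_dist_quadrilateral:
  "(euclid_dist k a c)\<^sup>2 + (euclid_dist k b d)\<^sup>2
    \<le> (euclid_dist k a b)\<^sup>2 + (euclid_dist k b c)\<^sup>2 + (euclid_dist k c d)\<^sup>2 + (euclid_dist k d a)\<^sup>2"
proof -
  have sq: "(euclid_dist k x y)\<^sup>2 = (\<Sum>i<k. (x i - y i)\<^sup>2)" for x y
    by (simp add: euclid_dist_def L2_set_def sum_nonneg)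
  have "(a i - c i)\<^sup>2 + (b i - d i)\<^sup>2 \<le> (a i - b i)\<^sup>2 + (b i - c i)\<^sup>2 + (c i - d i)\<^sup>2 + (d i - a i)\<^sup>2" for i
    using zero_le_power2[of "a i - b i + c i - d i"] by (simp add: power2_eq_square algebra_simps)
  then show ?thesis unfolding sq sum.distrib[symmetric] by (rule sum_mono)
qed

section \<open>The parallelogram law for the norms of the tangent spaces\<close>

text \<open>
  For \<open>\<epsilon> > 0\<close> the vectors are scaled by a factor \<open>\<rho>\<close> so that the parallelogram that they span lies in the
  ball where \<open>finsler_dist_infinitesimal\<close> applies; the factor cancels by homogeneity, and then \<open>\<epsilon>\<close> tends
  to \<open>0\<close>.
\<close>

lemma (in finsler_manifold) coord_norm_parallelogram:
  assumes f: "path_isometry UNIV (finsler_dist A N) Y (euclid_dist k) f" and c: "c \<in> charts_at A p"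
  shows "2 * (coord_norm A N c p v)\<^sup>2 + 2 * (coord_norm A N c p w)\<^sup>2
    \<le> (coord_norm A N c p (v + w))\<^sup>2 + (coord_norm A N c p (v - w))\<^sup>2"
proof -
  let ?\<psi> = "inv_into (fst c) (snd c)" and ?x0 = "snd c p" and ?n = "coord_norm A N c p"
  let ?d = "finsler_dist A N" and ?D = "\<lambda>x y. euclid_dist k (f (?\<psi> x)) (f (?\<psi> y))"
  note n = coord_norm_norm_function[OF c] coord_norm_continuous_at[OF c]
  show ?thesis
  proof (cases "v = 0 \<or> w = 0")
    case True
    then show ?thesis using norm_function_eq_0[OF n(1), of 0] norm_function_minus[OF n(1), of w] by auto
  next
    case False
    then have pos: "?n v > 0" "?n w > 0"
      using norm_function_eq_0[OF n(1)] norm_function_nonneg[OF n(1)] by (metis less_eq_real_def)+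
    have approx: "2 * ((1 - \<epsilon>)\<^sup>2 * ?n v)\<^sup>2 + 2 * ((1 - \<epsilon>)\<^sup>2 * ?n w)\<^sup>2
        \<le> (1 + \<epsilon>)\<^sup>2 * ((?n (v + w))\<^sup>2 + (?n (v - w))\<^sup>2)" if \<epsilon>: "0 < \<epsilon>" "\<epsilon> < 1" for \<epsilon>
    proof -
      obtain r where r: "r > 0"
        and lower: "\<And>x y. x \<in> ball ?x0 r \<Longrightarrow> y \<in> ball ?x0 r \<Longrightarrow> (1 - \<epsilon>) * ?n (y - x) \<le> ?d (?\<psi> x) (?\<psi> y)"
        and upper: "\<And>x y. x \<in> ball ?x0 r \<Longrightarrow> y \<in> ball ?x0 r \<Longrightarrow> ?d (?\<psi> x) (?\<psi> y) \<le> (1 + \<epsilon>) * ?n (y - x)"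
        using finsler_dist_infinitesimal[OF c \<epsilon>] by metis
      have lip: "?d (?\<psi> (x + s *\<^sub>R (y - x))) (?\<psi> (x + t *\<^sub>R (y - x))) \<le> ((1 + \<epsilon>) * ?n (y - x)) * \<bar>s - t\<bar>"
        if x: "x \<in> ball ?x0 r" and y: "y \<in> ball ?x0 r" and st: "s \<in> {0..1}" "t \<in> {0..1}" for x y s t
      proof -
        have seg: "x + s *\<^sub>R (y - x) \<in> ball ?x0 r" if "s \<in> {0..1}" for s
          using convexD[OF convex_ball x y, of "1 - s" s] that by (simp add: algebra_simps)
        have "?d (?\<psi> (x + s *\<^sub>R (y - x))) (?\<psi> (x + t *\<^sub>R (y - x)))
            \<le> (1 + \<epsilon>) * ?n ((x + t *\<^sub>R (y - x)) - (x + s *\<^sub>R (y - x)))"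
          by (intro upper seg st)
        also have "(x + t *\<^sub>R (y - x)) - (x + s *\<^sub>R (y - x)) = (t - s) *\<^sub>R (y - x)"
          by (simp add: algebra_simps)
        finally show ?thesis by (simp add: norm_function_scale[OF n(1)] mult_ac abs_minus_commute)
      qed
      have K: "0 \<le> (1 + \<epsilon>) * ?n z" for z using norm_function_nonneg[OF n(1), of z] \<epsilon> by simp
      define \<rho> where "\<rho> = r / (norm v + norm w + 1)"
      have "norm v + norm w + 1 > 0" by (smt (verit) norm_ge_zero)
      then have \<rho>: "\<rho> > 0" "\<rho> * (norm v + norm w) < r" using r by (auto simp: \<rho>_def field_simps)
      have scale: "?n (\<rho> *\<^sub>R z) = \<rho> * ?n z" for z using \<rho>(1) by (simp add: norm_function_scale[OF n(1)])
      have "2 * ((\<rho> * ((1 - \<epsilon>)\<^sup>2 * ?n v))\<^sup>2 + (\<rho> * ((1 - \<epsilon>)\<^sup>2 * ?n w))\<^sup>2)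
          \<le> (1 + \<epsilon>)\<^sup>2 * ((?n (\<rho> *\<^sub>R v + \<rho> *\<^sub>R w))\<^sup>2 + (?n (\<rho> *\<^sub>R v - \<rho> *\<^sub>R w))\<^sup>2)"
      proof (rule parallelogram_estimate[where D = ?D and Q = "ball ?x0 r" and ?x0.0 = ?x0 and \<mu> = "1 - \<epsilon>", OF n])
        show "?x0 + s *\<^sub>R (\<rho> *\<^sub>R v) + t *\<^sub>R (\<rho> *\<^sub>R w) \<in> ball ?x0 r"
          if st: "s \<in> {0..1}" "t \<in> {0..1}" for s t
        proof -
          have "norm (s *\<^sub>R (\<rho> *\<^sub>R v) + t *\<^sub>R (\<rho> *\<^sub>R w)) \<le> norm (s *\<^sub>R (\<rho> *\<^sub>R v)) + norm (t *\<^sub>R (\<rho> *\<^sub>R w))"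
            by (rule norm_triangle_ineq)
          also have "\<dots> = s * (\<rho> * norm v) + t * (\<rho> * norm w)" using st \<rho>(1) by simp
          also have "\<dots> \<le> 1 * (\<rho> * norm v) + 1 * (\<rho> * norm w)"
            using st \<rho>(1) by (intro add_mono mult_right_mono) auto
          also have "\<dots> < r" using \<rho>(2) by (simp add: algebra_simps)
          finally have "dist 0 (s *\<^sub>R (\<rho> *\<^sub>R v) + t *\<^sub>R (\<rho> *\<^sub>R w)) < r" by simp
          moreover have "dist ?x0 (?x0 + a) = dist 0 a" for a by (simp add: dist_norm)
          ultimately show ?thesis unfolding mem_ball add.assoc by metis
        qed
        show "?D x y \<le> (1 + \<epsilon>) * ?n (y - x)" if xy: "x \<in> ball ?x0 r" "y \<in> ball ?x0 r" for x y
          using path_isometry_lipschitz_curve(2)[OF f K[of "y - x"], of "\<lambda>t. ?\<psi> (x + t *\<^sub>R (y - x))"]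
            lip[OF xy] by simp
        show "\<exists>k' \<tau>. subdivision 0 1 k' \<tau> \<and>
            b < (\<Sum>i<k'. ?D (x + \<tau> i *\<^sub>R (y - x)) (x + \<tau> (Suc i) *\<^sub>R (y - x)))"
          if xy: "x \<in> ball ?x0 r" "y \<in> ball ?x0 r" and b: "b < (1 - \<epsilon>) * ?n (y - x)" for x y b
        proof (rule path_isometry_image_length[OF f K[of "y - x"], where \<gamma> = "\<lambda>t. ?\<psi> (x + t *\<^sub>R (y - x))"])
          show "b < ?d (?\<psi> (x + 0 *\<^sub>R (y - x))) (?\<psi> (x + 1 *\<^sub>R (y - x)))"
            using b lower[OF xy] by simp
        qed (use lip[OF xy] euclid_dist_nonneg in auto)
        \<comment> \<open>The square of \<open>1 - \<epsilon>\<close> provides the strict inequality that \<open>parallelogram_estimate\<close> asks for.\<close>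
        have strict: "\<rho> * ((1 - \<epsilon>)\<^sup>2 * a) < (1 - \<epsilon>) * (\<rho> * a)" if "a > 0" for a
        proof -
          have "(1 - \<epsilon>) * ((1 - \<epsilon>) * (\<rho> * a)) < 1 * ((1 - \<epsilon>) * (\<rho> * a))"
            using \<epsilon> \<rho>(1) that by (intro mult_strict_right_mono) auto
          then show ?thesis by (simp add: power2_eq_square mult_ac)
        qed
        show "\<rho> * ((1 - \<epsilon>)\<^sup>2 * ?n v) < (1 - \<epsilon>) * ?n (\<rho> *\<^sub>R v)"
          "\<rho> * ((1 - \<epsilon>)\<^sup>2 * ?n w) < (1 - \<epsilon>) * ?n (\<rho> *\<^sub>R w)"
          unfolding scale by (intro strict pos)+
        show "0 \<le> \<rho> * ((1 - \<epsilon>)\<^sup>2 * ?n v)" "0 \<le> \<rho> * ((1 - \<epsilon>)\<^sup>2 * ?n w)" "0 \<le> 1 + \<epsilon>"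
          using pos \<rho>(1) \<epsilon> by auto
      qed (rule euclid_dist_nonneg euclid_dist_self euclid_dist_commute euclid_dist_triangle euclid_dist_quadrilateral)+
      then have "\<rho>\<^sup>2 * (2 * ((1 - \<epsilon>)\<^sup>2 * ?n v)\<^sup>2 + 2 * ((1 - \<epsilon>)\<^sup>2 * ?n w)\<^sup>2)
          \<le> \<rho>\<^sup>2 * ((1 + \<epsilon>)\<^sup>2 * ((?n (v + w))\<^sup>2 + (?n (v - w))\<^sup>2))"
        unfolding scaleR_add_right[symmetric] scaleR_diff_right[symmetric] scale power_mult_distrib
        by (simp add: algebra_simps)
      then show ?thesis using \<rho>(1) by (simp add: mult_le_cancel_left_pos)
    qed
    have "((\<lambda>\<epsilon>. 2 * ((1 - \<epsilon>)\<^sup>2 * ?n v)\<^sup>2 + 2 * ((1 - \<epsilon>)\<^sup>2 * ?n w)\<^sup>2)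
        \<longlongrightarrow> 2 * ((1 - 0)\<^sup>2 * ?n v)\<^sup>2 + 2 * ((1 - 0)\<^sup>2 * ?n w)\<^sup>2) (at_right 0)"
      by (intro tendsto_intros)
    moreover have "((\<lambda>\<epsilon>. (1 + \<epsilon>)\<^sup>2 * ((?n (v + w))\<^sup>2 + (?n (v - w))\<^sup>2))
        \<longlongrightarrow> (1 + 0)\<^sup>2 * ((?n (v + w))\<^sup>2 + (?n (v - w))\<^sup>2)) (at_right 0)"
      by (intro tendsto_intros)
    moreover have "\<forall>\<^sub>F \<epsilon> in at_right (0::real). 2 * ((1 - \<epsilon>)\<^sup>2 * ?n v)\<^sup>2 + 2 * ((1 - \<epsilon>)\<^sup>2 * ?n w)\<^sup>2
        \<le> (1 + \<epsilon>)\<^sup>2 * ((?n (v + w))\<^sup>2 + (?n (v - w))\<^sup>2)"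
      using approx by (auto simp: eventually_at_right_field intro: exI[of _ 1])
    ultimately show ?thesis using tendsto_le[OF trivial_limit_at_right_real] by fastforce
  qed
qed

theorem proposition2p8:
  fixes A :: "('a::{t2_space,second_countable_topology},
               'e::{real_normed_vector,heine_borel}) chart set"
    and N :: "'a \<Rightarrow> ('a, 'e) tangent \<Rightarrow> real"
  assumes "finsler_manifold A N"
    and "\<exists>k f. path_isometry UNIV (finsler_dist A N) (topspace (Euclidean_space k)) (euclid_dist k) f"
  shows "\<forall>p. \<exists>g. scalar_product_on (tangent_space A p) g \<and>
                 (\<forall>v\<in>tangent_space A p. N p v = sqrt (g v v))"
proof
  fix p
  interpret finsler_manifold A N by fact
  obtain k f where f: "path_isometry UNIV (finsler_dist A N) (topspace (Euclidean_space k)) (euclid_dist k) f"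
    using assms(2) by blast
  obtain c where c: "c \<in> charts_at A p" using charts_at_nonempty by blast
  note n = coord_norm_norm_function[OF c]
  obtain B where B: "\<And>v w. B v w = B w v" "\<And>u v w. B (u + v) w = B u w + B v w"
    "\<And>r v w. B (r *\<^sub>R v) w = r * B v w" "\<And>v. B v v = (coord_norm A N c p v)\<^sup>2"
    using jordan_von_neumann[OF n coord_norm_parallelogram[OF f c]] by blast
  have N: "N p v = coord_norm A N c p (v c)" if "v \<in> tangent_space A p" for v
    using tangent_vector_of_coord[OF c that] by (simp add: coord_norm_def)
  show "\<exists>g. scalar_product_on (tangent_space A p) g \<and> (\<forall>v\<in>tangent_space A p. N p v = sqrt (g v v))"
  proof (intro exI conjI ballI)
    have "B (v c) (v c) > 0" if v: "v \<in> tangent_space A p" "v \<noteq> (\<lambda>c. 0)" for v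
    proof -
      have "N p v \<noteq> 0" using norm[of p] v unfolding norm_on_def by blast
      then show ?thesis using N[OF v(1)] by (simp add: B(4))
    qed
    then show "scalar_product_on (tangent_space A p) (\<lambda>v w. B (v c) (w c))"
      unfolding scalar_product_on_def using B(1-3) by blast
    show "N p v = sqrt (B (v c) (v c))" if "v \<in> tangent_space A p" for v
      using N[OF that] norm_function_nonneg[OF n] by (simp add: B(4))
  qed
qed

end
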